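(* Let $\{\psi_n^{(2)}\}_{n\ge0}$, $\{\psi_n^{(5)}\}_{n\ge0}$, $\{\psi_n^{(6)}\}_{n\ge0}$ be the three basic families of Dirichlet eigenfunctions on $\mathcal{SG}$ (defined in the context). For every $n\ge0$, the numbers of local extrema of $\psi_n^{(2)}$, $\psi_n^{(5)}$ and $\psi_n^{(6)}$ along the bottom edge of $\mathcal{SG}$ are $2n+1$, $4[\frac n2]+2$ and $8n+3$ respectively, and the number of local extrema of $\psi_n^{(5)}$ along the left edge of $\mathcal{SG}$ is $2[\frac n2]+n+1$.
   Context: Sierpinski gasket. Let $x_0$ (bottom left), $x_1$ (bottom right), $x_2$ (top) be the vertices of an equilateral triangle in $\mathbb{R}^2$, $F_i(x)=\frac12(x-x_i)+x_i$, and $\mathcal{SG}$ the attractor of $\{F_0,F_1,F_2\}$. Put $V_0=\{x_0,x_1,x_2\}$, $V_m=\bigcup_iF_iV_{m-1}$, $V_*=\bigcup_mV_m$; for a word $w=w_1\cdots w_m$, $w_i\in\{0,1,2\}$, $F_w=F_{w_1}\circ\cdots\circ F_{w_m}$, and $F_w\mathcal{SG}$ is an $m$-cell with boundary vertices $F_wV_0$. For $x\neq y$ in $V_m$, $x\sim_my$ iff $x,y\in F_wV_0$ for some $|w|=m$. The bottom edge is the segment $\overline{x_0x_1}$, the left edge is $\overline{x_0x_2}$. Let $y_0,y_1,y_2$ be the midpoints of $\overline{x_1x_2},\overline{x_0x_2},\overline{x_0x_1}$ respectively, so $V_1\setminus V_0=\{y_0,y_1,y_2\}$. Laplacian. $\Delta_mu(x)=\sum_{y\sim_mx}(u(y)-u(x))$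 for $x\in V_m\setminus V_0$, and $\Delta u(x)=\frac32\lim_m5^m\Delta_mu(x)$ (uniform convergence on $V_*\setminus V_0$ to a continuous function). Eigenfunctions are non-zero $u$ with $-\Delta u=\lambda u$; Dirichlet means $u|_{V_0}=0$. Spectral decimation (known). Starting from a graph eigenfunction $u$ on $V_m$, $-\Delta_mu=\lambda_mu$, choose $\varepsilon_{m'}\in\{\pm1\}$ for $m'>m$, all but finitely many equal to $-1$, put $\lambda_{m'}=\frac{5+\varepsilon_{m'}\sqrt{25-4\lambda_{m'-1}}}2$, and extend $u$ successively: on each $(m'-1)$-cell with boundary vertices $p_0,p_1,p_2$, $$u(p_{ij})=\frac{(4-\lambda_{m'})(u(p_i)+u(p_j))+2u(p_k)}{(2-\lambda_{m'})(5-\lambda_{m'})},\quad\{i,j,k\}=\{0,1,2\},$$ $p_{ij}$ the midpoint of the edge joining $p_i,p_j$ (provided $\lambda_{m'}\neq2,5$). The continuous extension to $\mathcal{SG}$ is an eigenfunction with eigenvalue $\lambda=\frac32\lim_{m'}5^{m'}\lambda_{m'}$. The three families. In each family all admissible eigenfunctions are indexed by $n=0,1,2,\dots$ so that the eigenvalue increases with $n$. - $\psi_n^{(2)}$: start on $V_1$ with $\lambda_1=2$, value $0$ on $V_0$ and $1$ at $y_0,y_1,y_2$; $\varepsilon_m\in\{\pm1\}$, $m\ge2$, arbitrary with all but finitely many equal to $-1$ ($\psi_0^{(2)}$ has all $\varepsilon_m=-1$). - $\psi_n^{(5)}$: start on $V_1$ with $\lambda_1=5$, value $0$ on $V_0$,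 $1$ at $y_1$, $-1$ at $y_0$, $0$ at $y_2$; $\varepsilon_m\in\{\pm1\}$, $m\ge2$, arbitrary with all but finitely many equal to $-1$ ($\psi_0^{(5)}$ has all $\varepsilon_m=-1$). - $\psi_n^{(6)}$: start on $V_2$ with $\lambda_2=6$ and the values: $0$ on $V_0$ and at $y_0,y_1$; $2$ at $y_2$; $-1$ at the midpoints of $\overline{x_0y_2}$, $\overline{x_1y_2}$, $\overline{y_1y_2}$, $\overline{y_0y_2}$; $1$ at the midpoints of $\overline{x_0y_1}$ and $\overline{x_1y_0}$; $0$ at the midpoints of $\overline{x_2y_1}$, $\overline{x_2y_0}$, $\overline{y_0y_1}$. Here $\varepsilon_3=1$ (so $\lambda_3=3$) always, and $\varepsilon_m\in\{\pm1\}$, $m\ge4$, arbitrary with all but finitely many equal to $-1$ ($\psi_0^{(6)}$ has $\varepsilon_m=-1$ for $m\ge4$). Local extrema along an edge are local extrema of the restriction to the edge at points other than its endpoints. $[x]$ is the largest integer not exceeding $x$. *)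

theory Defs
  imports "HOL-Analysis.Analysis"
begin

text \<open>
  The index type \<open>3\<close> has exactly the three elements \<open>0, 1, 2\<close>; its arithmetic is modulo 3.
  A triangle is a map \<open>q\<close> from \<open>3\<close> to the plane, and \<open>q 0, q 1, q 2\<close> are its bottom left,
  bottom right and top vertices.
\<close>

definition equilateral_triangle :: "(3 \<Rightarrow> real^2) \<Rightarrow> bool" where
  "equilateral_triangle q \<longleftrightarrow> (\<exists>s>0. \<forall>i j. i \<noteq> j \<longrightarrow> dist (q i) (q j) = s)"

definition F :: "(3 \<Rightarrow> real^2) \<Rightarrow> 3 \<Rightarrow> real^2 \<Rightarrow> real^2" where
  "F q i x = (1/2) *\<^sub>R (x - q i) + q i"

definition Fw :: "(3 \<Rightarrow> real^2) \<Rightarrow> 3 list \<Rightarrow> real^2 \<Rightarrow> real^2" where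
  "Fw q w = foldr (F q) w"

text \<open>The attractor; see \<open>ex1_attractor\<close> and \<open>SG_attractor\<close> below.\<close>

definition SG :: "(3 \<Rightarrow> real^2) \<Rightarrow> (real^2) set" where
  "SG q = (THE K. compact K \<and> K \<noteq> {} \<and> K = (\<Union>i. F q i ` K))"

primrec V :: "(3 \<Rightarrow> real^2) \<Rightarrow> nat \<Rightarrow> (real^2) set" where
  "V q 0 = range q"
| "V q (Suc m) = (\<Union>i. F q i ` V q m)"

definition adj :: "(3 \<Rightarrow> real^2) \<Rightarrow> nat \<Rightarrow> real^2 \<Rightarrow> real^2 \<Rightarrow> bool" where
  "adj q m x y \<longleftrightarrow> x \<noteq> y \<and>
     (\<exists>w. length w = m \<and> x \<in> Fw q w ` V q 0 \<and> y \<in> Fw q w ` V q 0)"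

definition graph_laplacian ::
    "(3 \<Rightarrow> real^2) \<Rightarrow> nat \<Rightarrow> (real^2 \<Rightarrow> real) \<Rightarrow> real^2 \<Rightarrow> real" where
  "graph_laplacian q m u x = (\<Sum>y | adj q m x y. u y - u x)"

text \<open>
  \<open>has_laplacian q u f\<close> states that \<open>\<Delta> u = f\<close> on \<open>SG q\<close>.  The graph Laplacian of level \<open>m\<close> is only
  meaningful on \<open>V q m - V q 0\<close>, so the convergence is uniform over these sets, which exhaust
  the non-boundary vertices of all levels.
  Functions on \<open>SG q\<close> are total functions on the plane whose values outside \<open>SG q\<close> are irrelevant.
\<close>

definition has_laplacian ::
    "(3 \<Rightarrow> real^2) \<Rightarrow> (real^2 \<Rightarrow> real) \<Rightarrow> (real^2 \<Rightarrow> real) \<Rightarrow> bool" where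
  "has_laplacian q u f \<longleftrightarrow> continuous_on (SG q) u \<and> continuous_on (SG q) f \<and>
     (\<forall>e>0. \<exists>N. \<forall>m\<ge>N. \<forall>x \<in> V q m - V q 0.
        \<bar>3/2 * 5 ^ m * graph_laplacian q m u x - f x\<bar> < e)"

definition dirichlet_eigenfunction ::
    "(3 \<Rightarrow> real^2) \<Rightarrow> (real^2 \<Rightarrow> real) \<Rightarrow> real \<Rightarrow> bool" where
  "dirichlet_eigenfunction q u l \<longleftrightarrow>
     (\<exists>x \<in> SG q. u x \<noteq> 0) \<and> (\<forall>x \<in> V q 0. u x = 0) \<and> has_laplacian q u (\<lambda>x. - l * u x)"

text \<open>
  \<open>decimation_value m0 l0 \<epsilon> k\<close> is \<open>\<lambda>\<^sub>m\<close> for \<open>m = m0 + k\<close>, starting from the value \<open>l0\<close> at level \<open>m0\<close>.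
\<close>

primrec decimation_value :: "nat \<Rightarrow> real \<Rightarrow> (nat \<Rightarrow> real) \<Rightarrow> nat \<Rightarrow> real" where
  "decimation_value m0 l0 \<epsilon> 0 = l0"
| "decimation_value m0 l0 \<epsilon> (Suc k) =
     (5 + \<epsilon> (m0 + Suc k) * sqrt (25 - 4 * decimation_value m0 l0 \<epsilon> k)) / 2"

definition admissible_signs :: "nat \<Rightarrow> (nat \<Rightarrow> real) set" where
  "admissible_signs m0 =
     {\<epsilon>. (\<forall>m>m0. \<epsilon> m \<in> {1, -1}) \<and> finite {m. m > m0 \<and> \<epsilon> m \<noteq> -1}}"

text \<open>
  \<open>u\<close> is a continuous function on \<open>SG q\<close> that, on every cell of level \<open>m \<ge> m0\<close>, obeys the spectral
  decimation rule leading from level \<open>m\<close> to level \<open>m + 1\<close>.  In the three families below no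
  denominator vanishes: a value \<open>2\<close> or \<open>5\<close> is only reached from a preceding value \<open>6\<close> or \<open>0\<close>,
  and for the start value \<open>6\<close> the sign at level 3 is \<open>1\<close>.
\<close>

definition decimation_extension ::
    "(3 \<Rightarrow> real^2) \<Rightarrow> nat \<Rightarrow> real \<Rightarrow> (nat \<Rightarrow> real) \<Rightarrow> (real^2 \<Rightarrow> real) \<Rightarrow> bool" where
  "decimation_extension q m0 l0 \<epsilon> u \<longleftrightarrow> continuous_on (SG q) u \<and>
     (\<forall>m\<ge>m0. \<forall>w. length w = m \<longrightarrow>
        (let p = (\<lambda>i. Fw q w (q i)); l = decimation_value m0 l0 \<epsilon> (Suc m - m0) in
         \<forall>i j k. distinct [i, j, k] \<longrightarrow>
           u (midpoint (p i) (p j)) =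
             ((4 - l) * (u (p i) + u (p j)) + 2 * u (p k)) / ((2 - l) * (5 - l))))"

text \<open>\<open>ymid q i\<close> is the midpoint of the edge opposite to \<open>q i\<close>.\<close>

definition ymid :: "(3 \<Rightarrow> real^2) \<Rightarrow> 3 \<Rightarrow> real^2" where
  "ymid q i = midpoint (q (i + 1)) (q (i + 2))"

definition start2 :: "(3 \<Rightarrow> real^2) \<Rightarrow> (real^2 \<Rightarrow> real) \<Rightarrow> bool" where
  "start2 q u \<longleftrightarrow> (\<forall>i. u (q i) = 0) \<and> (\<forall>i. u (ymid q i) = 1)"

definition start5 :: "(3 \<Rightarrow> real^2) \<Rightarrow> (real^2 \<Rightarrow> real) \<Rightarrow> bool" where
  "start5 q u \<longleftrightarrow> (\<forall>i. u (q i) = 0) \<and>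
     u (ymid q 1) = 1 \<and> u (ymid q 0) = -1 \<and> u (ymid q 2) = 0"

definition start6 :: "(3 \<Rightarrow> real^2) \<Rightarrow> (real^2 \<Rightarrow> real) \<Rightarrow> bool" where
  "start6 q u \<longleftrightarrow> (\<forall>i. u (q i) = 0) \<and>
     u (ymid q 0) = 0 \<and> u (ymid q 1) = 0 \<and> u (ymid q 2) = 2 \<and>
     u (midpoint (q 0) (ymid q 2)) = -1 \<and> u (midpoint (q 1) (ymid q 2)) = -1 \<and>
     u (midpoint (ymid q 1) (ymid q 2)) = -1 \<and> u (midpoint (ymid q 0) (ymid q 2)) = -1 \<and>
     u (midpoint (q 0) (ymid q 1)) = 1 \<and> u (midpoint (q 1) (ymid q 0)) = 1 \<and>
     u (midpoint (q 2) (ymid q 1)) = 0 \<and> u (midpoint (q 2) (ymid q 0)) = 0 \<and>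
     u (midpoint (ymid q 0) (ymid q 1)) = 0"

text \<open>
  \<open>enumerates_by_eigenvalue q S R \<psi>\<close>: the functions \<open>\<psi> 0, \<psi> 1, \<dots>\<close> are Dirichlet eigenfunctions
  with strictly increasing eigenvalues, each of them is generated (relation \<open>R\<close>) by some sign
  sequence in \<open>S\<close>, and each sign sequence in \<open>S\<close> generates one of them.
\<close>

definition enumerates_by_eigenvalue ::
    "(3 \<Rightarrow> real^2) \<Rightarrow> (nat \<Rightarrow> real) set \<Rightarrow> ((nat \<Rightarrow> real) \<Rightarrow> (real^2 \<Rightarrow> real) \<Rightarrow> bool) \<Rightarrow>
     (nat \<Rightarrow> real^2 \<Rightarrow> real) \<Rightarrow> bool" where
  "enumerates_by_eigenvalue q S R \<psi> \<longleftrightarrow>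
     (\<exists>\<Lambda>. strict_mono \<Lambda> \<and> (\<forall>n. dirichlet_eigenfunction q (\<psi> n) (\<Lambda> n))) \<and>
     (\<forall>n. \<exists>\<epsilon>\<in>S. R \<epsilon> (\<psi> n)) \<and> (\<forall>\<epsilon>\<in>S. \<exists>n. R \<epsilon> (\<psi> n))"

definition is_family2 :: "(3 \<Rightarrow> real^2) \<Rightarrow> (nat \<Rightarrow> real^2 \<Rightarrow> real) \<Rightarrow> bool" where
  "is_family2 q = enumerates_by_eigenvalue q (admissible_signs 1)
     (\<lambda>\<epsilon> u. start2 q u \<and> decimation_extension q 1 2 \<epsilon> u)"

definition is_family5 :: "(3 \<Rightarrow> real^2) \<Rightarrow> (nat \<Rightarrow> real^2 \<Rightarrow> real) \<Rightarrow> bool" where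
  "is_family5 q = enumerates_by_eigenvalue q (admissible_signs 1)
     (\<lambda>\<epsilon> u. start5 q u \<and> decimation_extension q 1 5 \<epsilon> u)"

definition is_family6 :: "(3 \<Rightarrow> real^2) \<Rightarrow> (nat \<Rightarrow> real^2 \<Rightarrow> real) \<Rightarrow> bool" where
  "is_family6 q = enumerates_by_eigenvalue q {\<epsilon> \<in> admissible_signs 2. \<epsilon> 3 = 1}
     (\<lambda>\<epsilon> u. start6 q u \<and> decimation_extension q 2 6 \<epsilon> u)"

text \<open>Extrema are not required to be strict.\<close>

definition edge_extrema :: "real^2 \<Rightarrow> real^2 \<Rightarrow> (real^2 \<Rightarrow> real) \<Rightarrow> (real^2) set" where
  "edge_extrema a b u = {x \<in> open_segment a b. \<exists>e>0.
     (\<forall>y \<in> closed_segment a b. dist y x < e \<longrightarrow> u y \<le> u x) \<or>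
     (\<forall>y \<in> closed_segment a b. dist y x < e \<longrightarrow> u y \<ge> u x)}"

lemma F_dist: "dist (F q i x) (F q i y) = dist x y / 2"
proof -
  have "F q i x - F q i y = (1/2) *\<^sub>R (x - y)"
    unfolding F_def by (simp add: algebra_simps)
  then show ?thesis by (simp add: dist_norm)
qed

lemma F_continuous: "continuous_on A (F q i)"
  unfolding F_def by (intro continuous_intros)

lemma attractor_subset:
  assumes K: "compact K" "K = (\<Union>i. F q i ` K)"
    and L: "compact L" "L \<noteq> {}" "L = (\<Union>i. F q i ` L)"
  shows "K \<subseteq> L"
proof (cases "K = {}")
  case False
  have "continuous_on K (\<lambda>x. infdist x L)" by (intro continuous_intros)
  from continuous_attains_sup[OF K(1) False this]
  obtain x where x: "x \<in> K" "\<And>y. y \<in> K \<Longrightarrow> infdist y L \<le> infdist x L" by blast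
  from x(1) K(2) obtain i x' where x': "x' \<in> K" "x = F q i x'" by blast
  from infdist_attains_inf[OF compact_imp_closed[OF L(1)] L(2)] obtain y where y: "y \<in> L" "infdist x' L = dist x' y"
    by blast
  have "F q i y \<in> L" using L(3) y(1) by blast
  then have "infdist x L \<le> dist (F q i x') (F q i y)" using x'(2) by (auto intro: infdist_le)
  also have "\<dots> = infdist x' L / 2" by (simp add: F_dist y(2))
  also have "\<dots> \<le> infdist x L / 2" using x(2)[OF x'(1)] by simp
  finally have "infdist x L \<le> 0" by simp
  then have "infdist z L = 0" if "z \<in> K" for z
    using x(2)[OF that] infdist_nonneg[of z L] by linarith
  then show ?thesis
    using in_closed_iff_infdist_zero[OF compact_imp_closed[OF L(1)] L(2)] by blast
qed simp

lemma ex1_attractor: "\<exists>!K. compact K \<and> K \<noteq> {} \<and> K = (\<Union>i. F q i ` K)"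
proof -
  define W where "W = (\<Union>m. V q m)"
  have mono: "V q m \<subseteq> V q (Suc m)" for m
  proof (induction m)
    case 0
    have "q i = F q i (q i)" for i by (simp add: F_def)
    then show ?case by fastforce
  next
    case (Suc m)
    then show ?case by fastforce
  qed
  have W: "W = (\<Union>i. F q i ` W)"
  proof
    show "W \<subseteq> (\<Union>i. F q i ` W)" unfolding W_def using mono by fastforce
    show "(\<Union>i. F q i ` W) \<subseteq> W"
    proof
      fix x assume "x \<in> (\<Union>i. F q i ` W)"
      then obtain i m y where "y \<in> V q m" "x = F q i y" unfolding W_def by blast
      then have "x \<in> V q (Suc m)" by auto
      then show "x \<in> W" unfolding W_def by blast
    qed
  qed
  obtain B where B: "\<And>i. norm (q i) \<le> B"
    using finite_imp_bounded[of "range q"] by (auto simp: bounded_iff)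
  have bV: "x \<in> V q m \<Longrightarrow> norm x \<le> B" for x m
  proof (induction m arbitrary: x)
    case 0
    then show ?case using B by auto
  next
    case (Suc m)
    then obtain i y where y: "y \<in> V q m" "x = F q i y" by auto
    have "x = (1/2) *\<^sub>R y + (1/2) *\<^sub>R q i"
      unfolding y(2) F_def by (simp add: algebra_simps flip: scaleR_left_distrib)
    then have "norm x \<le> norm y / 2 + norm (q i) / 2"
      using norm_triangle_ineq[of "(1/2) *\<^sub>R y" "(1/2) *\<^sub>R q i"] by simp
    then show ?case using Suc.IH[OF y(1)] B[of i] by linarith
  qed
  then have "bounded W" unfolding W_def bounded_iff by blast
  then have cW: "compact (closure W)" by simp
  have img: "F q i ` closure W = closure (F q i ` W)" for i
  proof
    show "F q i ` closure W \<subseteq> closure (F q i ` W)"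
      by (rule image_closure_subset[OF F_continuous]) (auto intro: closure_subset[THEN subsetD])
    have "closed (F q i ` closure W)"
      using compact_continuous_image[OF F_continuous cW] compact_imp_closed by blast
    then show "closure (F q i ` W) \<subseteq> F q i ` closure W"
      by (intro closure_minimal) (use closure_subset in auto)
  qed
  have "closure W = closure (\<Union>i. F q i ` W)" using W by simp
  also have "\<dots> = (\<Union>i. F q i ` closure W)"
  proof
    have "closed (\<Union>i. closure (F q i ` W))" by (intro closed_UN) auto
    then show "closure (\<Union>i. F q i ` W) \<subseteq> (\<Union>i. F q i ` closure W)"
      unfolding img by (intro closure_minimal UN_mono closure_subset) auto
    show "(\<Union>i. F q i ` closure W) \<subseteq> closure (\<Union>i. F q i ` W)"
      unfolding img by (intro UN_least closure_mono) blast
  qed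
  finally have eq: "closure W = (\<Union>i. F q i ` closure W)" .
  have "q 0 \<in> W" unfolding W_def by (rule UN_I[of 0]) auto
  then have "closure W \<noteq> {}" by auto
  show ?thesis
  proof (rule ex1I)
    show "compact (closure W) \<and> closure W \<noteq> {} \<and> closure W = (\<Union>i. F q i ` closure W)"
      using cW \<open>closure W \<noteq> {}\<close> eq by blast
  next
    fix K assume K: "compact K \<and> K \<noteq> {} \<and> K = (\<Union>i. F q i ` K)"
    show "K = closure W"
    proof
      show "K \<subseteq> closure W"
        using K cW \<open>closure W \<noteq> {}\<close> eq by (intro attractor_subset[of K q]) blast+
      show "closure W \<subseteq> K"
        using K cW eq by (intro attractor_subset[of "closure W" q]) blast+
    qed
  qed
qed

lemma SG_attractor: "compact (SG q) \<and> SG q \<noteq> {} \<and> SG q = (\<Union>i. F q i ` SG q)"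
  unfolding SG_def by (rule theI'[OF ex1_attractor])

end

theory Submission
  imports Defs
begin

text \<open>
  Restrict an eigenfunction \<open>u\<close> to an edge of the gasket.  A cell of level \<open>m\<close> along the edge has
  values \<open>a\<close>, \<open>b\<close> at its two vertices on the edge and a value \<open>c\<close> at its third vertex.  With the graph
  eigenvalue \<open>\<lambda>\<close> of level \<open>m\<close>, the number \<open>b + c - (2 - \<lambda>/2) a\<close> is a discrete normal derivative of
  \<open>u\<close> at the first vertex, taken inside this cell.  The graph eigenvalue equation at an interior vertex
  of the edge says precisely that its two cells give normal derivatives that cancel, so every dyadic
  point \<open>k/2^m\<close> of the edge carries one well-defined slope \<open>s\<^sub>k\<close>.

  The point of the proof is that spectral decimation acts on these slopes alone.  If \<open>l\<close> is the
  eigenvalue of level \<open>m + 1\<close>, an old vertex gets the slope \<open>g s\<^sub>k\<close> and a new midpoint gets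
  \<open>h (s\<^sub>k + s\<^sub>k\<^sub>+\<^sub>1)\<close>, where \<open>g = (6 - l) / ((2 - l) (5 - l))\<close> and \<open>h = g / (3 - l) > 0\<close>; moreover the
  increment of \<open>u\<close> over a cell is a positive multiple of \<open>s\<^sub>k + s\<^sub>k\<^sub>+\<^sub>1\<close> (\<open>slope_refinementI\<close>), as long as
  \<open>\<lambda> < 6\<close>.  The sign
  choice \<open>-1\<close> makes \<open>g\<close> positive, the choice \<open>1\<close> makes it negative.

  Once all further sign choices are \<open>-1\<close>, each step merely inserts a sign between two neighbouring
  signs.  Hence \<open>u\<close> is strictly monotone on a cell whose slopes do not have opposite signs, has exactly
  one extremum inside a cell whose slopes do, and has an extremum at an interior vertex exactly when
  the slope vanishes there.  So the number of extrema is half the total variation \<open>W\<close> of the sequence of signs,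
  up to a correction for zero slopes at the two ends (\<open>card_interior_extrema\<close>).  A step with sign \<open>-1\<close>
  does not change \<open>W\<close>; a step with sign \<open>1\<close> from level \<open>m\<close> flips the old slopes but not the new ones and
  replaces \<open>W\<close> by \<open>4 * 2^m - W\<close> (\<open>variation_Suc\<close>).

  The position \<open>n\<close> of an eigenvalue in its family obeys a reflection of the same kind.  The branch of the
  decimation map with sign \<open>-1\<close> is increasing, the other is decreasing and has larger values.  So the
  eigenvalues are ordered as a Gray code: after \<open>K\<close> choices a sign \<open>-1\<close> keeps the rank and a sign \<open>1\<close>
  replaces it by \<open>2^(K+1) - 1 - n\<close> (\<open>decimation_value_order\<close>).  Therefore \<open>W\<close> is a function of \<open>n\<close>,
  which is fixed by its value at \<open>n = 0\<close>, read off from the starting values of each family.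
\<close>

section \<open>Counting the extrema of a function from its slopes at dyadic points\<close>

definition interior_extrema :: "(real \<Rightarrow> real) \<Rightarrow> real set" where
  "interior_extrema f = {x \<in> {0<..<1}. \<exists>e>0.
     (\<forall>y\<in>{0..1}. dist y x < e \<longrightarrow> f y \<le> f x) \<or> (\<forall>y\<in>{0..1}. dist y x < e \<longrightarrow> f y \<ge> f x)}"

text \<open>
  The factor \<open>\<sigma>\<close> treats a function and its negative at once: \<open>\<sigma> = 1\<close> means strictly increasing and
  \<open>\<sigma> = -1\<close> strictly decreasing.
\<close>

definition rises :: "real \<Rightarrow> (real \<Rightarrow> real) \<Rightarrow> real \<Rightarrow> real \<Rightarrow> bool" where
  "rises \<sigma> f a b \<longleftrightarrow> (\<forall>x y. a \<le> x \<and> x < y \<and> y \<le> b \<longrightarrow> \<sigma> * f x < \<sigma> * f y)"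

lemma risesD: "rises \<sigma> f a b \<Longrightarrow> a \<le> x \<Longrightarrow> x < y \<Longrightarrow> y \<le> b \<Longrightarrow> \<sigma> * f x < \<sigma> * f y"
  by (simp add: rises_def)

lemma rises_join:
  assumes "rises \<sigma> f a b" "rises \<sigma> f b c"
  shows "rises \<sigma> f a c"
  unfolding rises_def
proof (intro allI impI)
  fix x y assume xy: "a \<le> x \<and> x < y \<and> y \<le> c"
  consider "y \<le> b" | "b \<le> x" | "x < b" "b < y" by linarith
  then show "\<sigma> * f x < \<sigma> * f y"
  proof cases
    case 3
    have "\<sigma> * f x < \<sigma> * f b" using risesD[OF assms(1)] xy 3 by simp
    also have "\<sigma> * f b < \<sigma> * f y" using risesD[OF assms(2)] xy 3 by simp
    finally show ?thesis .
  qed (use risesD[OF assms(1), of x y] risesD[OF assms(2), of x y] xy in auto)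
qed

lemma rises_not_extremum:
  assumes r: "rises \<sigma> f a b" and x: "a < x" "x < b" "0 \<le> a" "b \<le> 1"
  shows "x \<notin> interior_extrema f"
proof
  assume "x \<in> interior_extrema f"
  then obtain e where e: "e > 0"
    "(\<forall>y\<in>{0..1}. dist y x < e \<longrightarrow> f y \<le> f x) \<or> (\<forall>y\<in>{0..1}. dist y x < e \<longrightarrow> f y \<ge> f x)"
    by (auto simp: interior_extrema_def)
  define d where "d = min (e/2) (min (x - a) (b - x))"
  have d: "0 < d" "d < e" "a \<le> x - d" "x + d \<le> b" using e(1) x by (auto simp: d_def min_def)
  have m: "x - d \<in> {0..1}" "x + d \<in> {0..1}" "dist (x - d) x < e" "dist (x + d) x < e"
    using d x by (auto simp: dist_real_def)
  have lt: "\<sigma> * f (x - d) < \<sigma> * f x" "\<sigma> * f x < \<sigma> * f (x + d)"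
    by (rule risesD[OF r]; use d x in simp)+
  from e(2) m have "(f (x - d) \<le> f x \<and> f (x + d) \<le> f x) \<or> (f x \<le> f (x - d) \<and> f x \<le> f (x + d))"
    by blast
  with lt show False
    by (cases "0 \<le> \<sigma>") (auto dest: mult_left_mono[of _ _ \<sigma>] mult_left_mono_neg[of _ _ \<sigma>])
qed

lemma peak_extremum:
  assumes r: "rises \<sigma> f a x" "rises (- \<sigma>) f x b" and x: "a < x" "x < b" "0 \<le> a" "b \<le> 1"
    and \<sigma>: "\<sigma> \<noteq> 0"
  shows "x \<in> interior_extrema f"
proof -
  have *: "\<sigma> * f y \<le> \<sigma> * f x" if "dist y x < min (x - a) (b - x)" for y
  proof -
    have "\<bar>y - x\<bar> < x - a" "\<bar>y - x\<bar> < b - x" using that by (auto simp: dist_real_def)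
    then consider "y = x" | "a \<le> y" "y < x" | "x < y" "y \<le> b" by linarith
    then show ?thesis
      by cases (use risesD[OF r(1), of y x] risesD[OF r(2), of x y] in auto)
  qed
  have "(\<forall>y\<in>{0..1}. dist y x < min (x - a) (b - x) \<longrightarrow> f y \<le> f x) \<or>
        (\<forall>y\<in>{0..1}. dist y x < min (x - a) (b - x) \<longrightarrow> f y \<ge> f x)"
  proof (cases "\<sigma> > 0")
    case True
    then show ?thesis using * by (simp only: mult_le_cancel_left_pos) blast
  next
    case False
    then have "\<sigma> < 0" using \<sigma> by simp
    then show ?thesis using * by (simp only: mult_le_cancel_left_neg) blast
  qed
  moreover have "min (x - a) (b - x) > 0" using x by simp
  moreover have "x \<in> {0<..<1}" using x by simp
  ultimately show ?thesis unfolding interior_extrema_def by blast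
qed

text \<open>
  Here \<open>a\<close> is the slope at a fixed vertex and \<open>b\<close> the slope at its neighbour on ever finer levels.
  While \<open>b\<close> is negative, so is \<open>a + b\<close> on the next level, and then \<open>h \<le> g\<close> forces the quotient
  \<open>b / a\<close> to grow by at least \<open>1\<close> per step, which cannot go on.  Signs alone would not give this: a
  negative slope could follow a positive one at every scale.
\<close>

lemma eventually_nonneg_neighbour:
  fixes a b g h :: "nat \<Rightarrow> real"
  assumes a: "a 0 > 0" "\<And>d. a (Suc d) = g d * a d"
    and b: "\<And>d. b (Suc d) = h d * (a d + b d)"
    and gh: "\<And>d. 0 < h d" "\<And>d. h d \<le> g d"
  shows "\<exists>d. b d \<ge> 0"
proof (rule ccontr)
  assume "\<not> (\<exists>d. b d \<ge> 0)"
  then have neg: "b d < 0" for d by (simp add: not_le)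
  have g: "g d > 0" for d using gh[of d] by linarith
  have apos: "a d > 0" for d using a g by (induction d) auto
  have *: "(b 0 / a 0 + real d) * a d \<le> b d" for d
  proof (induction d)
    case 0
    show ?case using a(1) by simp
  next
    case (Suc d)
    have "a d + b d < 0"
      using neg[of "Suc d"] gh(1)[of d] by (simp add: b mult_less_0_iff)
    then have "g d * (a d + b d) \<le> h d * (a d + b d)"
      using gh(2)[of d] by (intro mult_right_mono_neg) auto
    moreover have "g d * ((b 0 / a 0 + real d) * a d) \<le> g d * b d"
      using Suc g[of d] by (intro mult_left_mono) auto
    ultimately show ?case by (simp add: a b algebra_simps)
  qed
  obtain d where "- (b 0 / a 0) < real d" using reals_Archimedean2 by blast
  then have "0 < (b 0 / a 0 + real d) * a d" using apos by (intro mult_pos_pos) auto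
  with * neg show False by (meson less_le_trans not_less_iff_gr_or_eq)
qed

lemma sum_lessThan_double:
  fixes c :: "nat \<Rightarrow> 'a::comm_monoid_add"
  shows "(\<Sum>k<2*n. c k) = (\<Sum>k<n. c (2*k) + c (2*k+1))"
  by (induction n) (auto simp: algebra_simps)

lemma sgn_scale: "x > 0 \<Longrightarrow> sgn (x * y) = sgn y" for x y :: real
  by (simp add: sgn_mult)

lemma sgn_add_between:
  "sgn b \<le> sgn a \<Longrightarrow> sgn b \<le> sgn (a + b) \<and> sgn (a + b) \<le> sgn a" for a b :: real
  by (cases a "0::real" rule: linorder_cases; cases b "0::real" rule: linorder_cases)
     (auto simp: sgn_if)

lemma average_between: "a \<le> x \<Longrightarrow> x < y \<Longrightarrow> y \<le> b \<Longrightarrow> a \<le> (x + y) / 2"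
    "a \<le> x \<Longrightarrow> x < y \<Longrightarrow> y \<le> b \<Longrightarrow> (x + y) / 2 \<le> b" for a b x y :: real
  by simp_all

lemma dyadic_between:
  assumes "0 \<le> x" "x < (y::real)"
  obtains d p where "x < real p / 2^(n+d)" "real p / 2^(n+d) < y"
proof -
  obtain d where d: "1 / (y - x) < 2^d" using real_arch_pow[of 2 "1 / (y - x)"] by auto
  have "1 < 2^d * (y - x)" using d assms by (simp add: field_simps)
  also have "\<dots> \<le> 2^(n+d) * (y - x)" using assms by (intro mult_right_mono) auto
  finally have big: "x * 2^(n+d) + 1 < y * 2^(n+d)" by (simp add: algebra_simps)
  define p where "p = Suc (nat \<lfloor>x * 2^(n+d)\<rfloor>)"
  have "0 \<le> x * 2^(n+d)" using assms by simp
  then have "x * 2^(n+d) < real p" "real p \<le> x * 2^(n+d) + 1"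
    unfolding p_def by linarith+
  then have "x < real p / 2^(n+d)" "real p / 2^(n+d) < y"
    using big by (simp_all add: field_simps)
  then show ?thesis by (rule that)
qed

lemma unit_interval_cells: "{0..<1} = (\<Union>k<2^n. {real k / 2^n..<real (Suc k) / 2^n})"
proof (intro equalityI subsetI)
  fix x :: real assume x: "x \<in> {0..<1}"
  define k where "k = nat \<lfloor>x * 2^n\<rfloor>"
  have "0 \<le> x * 2^n" using x by simp
  then have k: "real k \<le> x * 2^n" "x * 2^n < real (Suc k)" unfolding k_def by linarith+
  have "x * 2^n < 1 * 2^n" using x by (intro mult_strict_right_mono) auto
  then have "real k < 2^n" using k(1) by linarith
  then have "k < 2^n" by (metis of_nat_less_iff of_nat_numeral of_nat_power)
  then show "x \<in> (\<Union>k<2^n. {real k / 2^n..<real (Suc k) / 2^n})"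
    using k by (auto simp: field_simps)
next
  fix x :: real assume "x \<in> (\<Union>k<2^n. {real k / 2^n..<real (Suc k) / 2^n})"
  then obtain k where k: "k < 2^n" "real k / 2^n \<le> x" "x < real (Suc k) / 2^n" by auto
  have "real (Suc k) \<le> 2^n" using k(1) by (metis Suc_leI of_nat_le_iff of_nat_numeral of_nat_power)
  then have "real (Suc k) / 2^n \<le> 1" by simp
  moreover have "0 \<le> real k / 2^n" by simp
  ultimately show "x \<in> {0..<1}" using k by (simp only: atLeastLessThan_iff) linarith
qed

text \<open>
  The data of an edge, with the geometry removed: \<open>f\<close> is the function along the edge, \<open>s m k\<close> its
  slope at \<open>k / 2^m\<close>, and \<open>\<epsilon>\<close> the sign choices.  The last two assumptions, which say that no two
  neighbouring slopes vanish and that a vanishing slope separates opposite signs, are required at the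
  level \<open>m1\<close> only, since refinement preserves both.
\<close>

locale slope_refinement =
  fixes f :: "real \<Rightarrow> real" and s :: "nat \<Rightarrow> nat \<Rightarrow> real" and c g h \<epsilon> :: "nat \<Rightarrow> real" and m1 :: nat
  assumes cont: "continuous_on {0..1} f"
    and increment: "\<And>m k. m1 \<le> m \<Longrightarrow> k < 2^m \<Longrightarrow>
          f (real (Suc k) / 2^m) - f (real k / 2^m) = c m * (s m k + s m (Suc k))"
    and old_slope: "\<And>m k. m1 \<le> m \<Longrightarrow> k \<le> 2^m \<Longrightarrow> s (Suc m) (2*k) = g m * s m k"
    and new_slope: "\<And>m k. m1 \<le> m \<Longrightarrow> k < 2^m \<Longrightarrow> s (Suc m) (2*k+1) = h m * (s m k + s m (Suc k))"
    and c_pos: "\<And>m. m1 \<le> m \<Longrightarrow> c m > 0"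
    and h_pos: "\<And>m. m1 \<le> m \<Longrightarrow> h m > 0"
    and signs: "\<And>m. m1 \<le> m \<Longrightarrow> \<epsilon> (Suc m) \<in> {1, -1}"
    and minus: "\<And>m. m1 \<le> m \<Longrightarrow> \<epsilon> (Suc m) = -1 \<Longrightarrow> h m \<le> g m"
    and plus: "\<And>m. m1 \<le> m \<Longrightarrow> \<epsilon> (Suc m) = 1 \<Longrightarrow> g m < 0"
    and start_nonzero: "\<And>k. k < 2^m1 \<Longrightarrow> s m1 k \<noteq> 0 \<or> s m1 (Suc k) \<noteq> 0"
    and start_flank: "\<And>k. Suc k < 2^m1 \<Longrightarrow> s m1 (Suc k) = 0 \<Longrightarrow> s m1 k * s m1 (Suc (Suc k)) < 0"
begin

lemma g_nonzero: "m1 \<le> m \<Longrightarrow> g m \<noteq> 0"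
  using signs[of m] minus[of m] plus[of m] h_pos[of m] by auto

lemma adjacent_nonzero: "m1 \<le> m \<Longrightarrow> k < 2^m \<Longrightarrow> s m k \<noteq> 0 \<or> s m (Suc k) \<noteq> 0"
proof (induction m arbitrary: k rule: dec_induct)
  case base
  then show ?case by (rule start_nonzero)
next
  case (step m)
  obtain j where j: "k = 2*j \<or> k = 2*j+1" by (metis oddE evenE)
  then have "j < 2^m" using step.prems by auto
  with step.IH[OF this] j show ?case
    using old_slope[OF step.hyps(1), of j] old_slope[OF step.hyps(1), of "Suc j"]
      new_slope[OF step.hyps(1), of j] h_pos[OF step.hyps(1)] g_nonzero[OF step.hyps(1)]
    by auto
qed

lemma zero_flank:
  "m1 \<le> m \<Longrightarrow> Suc k < 2^m \<Longrightarrow> s m (Suc k) = 0 \<Longrightarrow> s m k * s m (Suc (Suc k)) < 0"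
proof (induction m arbitrary: k rule: dec_induct)
  case base
  then show ?case by (intro start_flank)
next
  case (step m)
  note hyp = step.hyps(1)
  show ?case
  proof (cases "even k")
    case True
    then obtain j where j: "k = 2*j" by blast
    then have jb: "j < 2^m" using step.prems by auto
    have "s m j + s m (Suc j) = 0"
      using step.prems(2) new_slope[OF hyp jb] h_pos[OF hyp] j by auto
    with adjacent_nonzero[OF hyp jb] have "s m j * s m (Suc j) < 0"
      by (auto simp: mult_less_0_iff)
    moreover have "g m * g m > 0" using g_nonzero[OF hyp] by (metis not_real_square_gt_zero)
    ultimately have "(g m * g m) * (s m j * s m (Suc j)) < 0" by (simp add: mult_less_0_iff)
    then show ?thesis
      using old_slope[OF hyp, of j] old_slope[OF hyp, of "Suc j"] j jb by (simp add: mult_ac)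
  next
    case False
    then obtain j where j: "k = 2*j+1" by (auto elim: oddE)
    then have jb: "Suc j < 2^m" using step.prems by auto
    have z: "s m (Suc j) = 0"
      using step.prems(2) old_slope[OF hyp, of "Suc j"] g_nonzero[OF hyp] j jb by auto
    have "(h m * h m) * (s m j * s m (Suc (Suc j))) < 0"
      using step.IH[OF jb z] h_pos[OF hyp] by (simp add: mult_less_0_iff)
    then show ?thesis
      using new_slope[OF hyp, of j] new_slope[OF hyp, of "Suc j"] j jb z by (simp add: mult_ac)
  qed
qed

lemma start_zero_iff:
  assumes "m1 \<le> m"
  shows "s m 0 = 0 \<longleftrightarrow> s m1 0 = 0" and "s m (2^m) = 0 \<longleftrightarrow> s m1 (2^m1) = 0"
proof -
  have "(s m 0 = 0 \<longleftrightarrow> s m1 0 = 0) \<and> (s m (2^m) = 0 \<longleftrightarrow> s m1 (2^m1) = 0)"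
    using assms
  proof (induction m rule: dec_induct)
    case (step m)
    then show ?case
      using old_slope[of m 0] old_slope[of m "2^m"] g_nonzero[of m] by auto
  qed simp
  then show "s m 0 = 0 \<longleftrightarrow> s m1 0 = 0" "s m (2^m) = 0 \<longleftrightarrow> s m1 (2^m1) = 0" by auto
qed

text \<open>
  This weighs a cell with \<open>2\<close> if its slopes have opposite signs, with \<open>1\<close> if one of
  its slopes vanishes and with \<open>0\<close> otherwise, so that a zero vertex, whose two cells share one extremum,
  counts the same as a turning cell.
\<close>

definition variation :: "nat \<Rightarrow> real" where
  "variation m = (\<Sum>k<2^m. \<bar>sgn (s m k) - sgn (s m (Suc k))\<bar>)"

text \<open>
  The sign of \<open>s\<^sub>k + s\<^sub>k\<^sub>+\<^sub>1\<close> lies between the signs of its summands, so inserting it does not change the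
  variation.  If the old signs are flipped, each jump \<open>d\<close> becomes \<open>2 - d\<close>, and the two jumps of a
  refined cell add up to \<open>4\<close> minus the jump of the cell, provided that its slopes are not both zero.
\<close>

lemma variation_Suc:
  assumes m: "m1 \<le> m"
  shows "variation (Suc m) = (if \<epsilon> (Suc m) = -1 then variation m else 4 * 2^m - variation m)"
proof -
  have h: "h m > 0" by (rule h_pos[OF m])
  have "variation (Suc m) = (\<Sum>k<2*2^m. \<bar>sgn (s (Suc m) k) - sgn (s (Suc m) (Suc k))\<bar>)"
    by (simp add: variation_def)
  also have "\<dots> = (\<Sum>k<2^m. \<bar>sgn (g m) * sgn (s m k) - sgn (s m k + s m (Suc k))\<bar> +
                          \<bar>sgn (s m k + s m (Suc k)) - sgn (g m) * sgn (s m (Suc k))\<bar>)"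
    unfolding sum_lessThan_double
  proof (rule sum.cong[OF refl])
    fix k assume "k \<in> {..<2^m::nat}"
    then have k: "k < 2^m" by simp
    show "\<bar>sgn (s (Suc m) (2 * k)) - sgn (s (Suc m) (Suc (2 * k)))\<bar> +
         \<bar>sgn (s (Suc m) (2 * k + 1)) - sgn (s (Suc m) (Suc (2 * k + 1)))\<bar> =
         \<bar>sgn (g m) * sgn (s m k) - sgn (s m k + s m (Suc k))\<bar> +
         \<bar>sgn (s m k + s m (Suc k)) - sgn (g m) * sgn (s m (Suc k))\<bar>"
      using old_slope[OF m, of k] old_slope[OF m, of "Suc k"] new_slope[OF m k] k h
      by (simp add: sgn_mult)
  qed
  also have "\<dots> = (if \<epsilon> (Suc m) = -1 then variation m else 4 * 2^m - variation m)"
  proof (cases "\<epsilon> (Suc m) = -1")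
    case True
    then have "sgn (g m) = 1" using minus[OF m] h by (simp add: sgn_if)
    then show ?thesis using True unfolding variation_def
      by (auto intro!: sum.cong simp: sgn_if)
  next
    case False
    then have "\<epsilon> (Suc m) = 1" using signs[OF m] by auto
    then have g: "sgn (g m) = -1" using plus[OF m] by (simp add: sgn_if)
    have "\<bar>sgn (g m) * sgn (s m k) - sgn (s m k + s m (Suc k))\<bar> +
          \<bar>sgn (s m k + s m (Suc k)) - sgn (g m) * sgn (s m (Suc k))\<bar> =
          4 - \<bar>sgn (s m k) - sgn (s m (Suc k))\<bar>" if "k < 2^m" for k
      using adjacent_nonzero[OF m that] g by (auto simp: sgn_if)
    then have "?thesis \<longleftrightarrow> (\<Sum>k<2^m. 4 - \<bar>sgn (s m k) - sgn (s m (Suc k))\<bar>) = 4 * 2^m - variation m"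
      using False by simp
    then show ?thesis by (simp add: sum_subtractf variation_def)
  qed
  finally show ?thesis .
qed

end

text \<open>
  From the level \<open>M\<close> on all signs are \<open>-1\<close>, so that the sign pattern is only interpolated.
\<close>

locale final_slopes = slope_refinement +
  fixes M
  assumes M: "m1 \<le> M" and tail: "\<And>m. m > M \<Longrightarrow> \<epsilon> m = -1"
begin

lemma level: "M \<le> m \<Longrightarrow> m1 \<le> m" using M by simp

lemma gh: "M \<le> m \<Longrightarrow> 0 < h m" "M \<le> m \<Longrightarrow> h m \<le> g m" "M \<le> m \<Longrightarrow> 0 < g m"
  using h_pos[of m] minus[of m] tail[of "Suc m"] level by fastforce+

lemma nonneg_refine:
  assumes n: "M \<le> n" and j: "j \<le> 2^n" and nn: "\<And>k. i \<le> k \<Longrightarrow> k \<le> j \<Longrightarrow> 0 \<le> \<sigma> * s n k"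
  shows "i*2^d \<le> k \<Longrightarrow> k \<le> j*2^d \<Longrightarrow> 0 \<le> \<sigma> * s (n+d) k"
proof (induction d arbitrary: k)
  case 0
  then show ?case using nn by simp
next
  case (Suc d)
  have lev: "m1 \<le> n+d" "M \<le> n+d" using n level by auto
  have jb: "j*2^d \<le> 2^(n+d)" using j by (simp add: power_add)
  show ?case
  proof (cases "even k")
    case True
    then obtain l where l: "k = 2*l" by blast
    then have lb: "i*2^d \<le> l" "l \<le> j*2^d" using Suc.prems by auto
    then have "0 \<le> g (n+d) * (\<sigma> * s (n+d) l)"
      using Suc.IH[OF lb] gh(3)[OF lev(2)] by simp
    then show ?thesis using old_slope[OF lev(1), of l] lb jb l by (simp add: mult_ac)
  next
    case False
    then obtain l where l: "k = 2*l+1" by (auto elim: oddE)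
    then have lb: "i*2^d \<le> l" "Suc l \<le> j*2^d" using Suc.prems by auto
    then have "0 \<le> h (n+d) * (\<sigma> * s (n+d) l + \<sigma> * s (n+d) (Suc l))"
      using Suc.IH[of l] Suc.IH[of "Suc l"] gh(1)[OF lev(2)] by simp
    then show ?thesis using new_slope[OF lev(1), of l] lb jb l by (simp add: algebra_simps)
  qed
qed

text \<open>
  A run of slopes that are all nonnegative, up to the factor \<open>\<sigma>\<close>, stays such a run on all finer levels.
  Hence the increments between neighbouring dyadic points are positive, and continuity extends
  monotonicity from the dyadic points to the whole interval.
\<close>

lemma rises_run:
  assumes n: "M \<le> n" and ij: "i \<le> j" "j \<le> 2^n" and \<sigma>: "\<sigma> \<noteq> 0"
    and nn: "\<And>k. i \<le> k \<Longrightarrow> k \<le> j \<Longrightarrow> 0 \<le> \<sigma> * s n k"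
  shows "rises \<sigma> f (real i / 2^n) (real j / 2^n)"
proof -
  let ?p = "\<lambda>d k. real k / 2^(n+d)"
  have inc: "\<sigma> * f (?p d k) < \<sigma> * f (?p d (Suc k))" if k: "i*2^d \<le> k" "k < j*2^d" for d k
  proof -
    have lev: "m1 \<le> n+d" using n level by simp
    have kb: "k < 2^(n+d)" using k(2) ij(2) by (simp add: power_add order_less_le_trans)
    have "0 \<le> \<sigma> * s (n+d) k" "0 \<le> \<sigma> * s (n+d) (Suc k)"
      by (rule nonneg_refine[OF n ij(2), of i]; use nn k in simp)+
    moreover have "\<sigma> * s (n+d) k \<noteq> 0 \<or> \<sigma> * s (n+d) (Suc k) \<noteq> 0"
      using adjacent_nonzero[OF lev kb] \<sigma> by simp
    ultimately have "0 < \<sigma> * s (n+d) k + \<sigma> * s (n+d) (Suc k)" by linarith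
    then have "0 < c (n+d) * (\<sigma> * s (n+d) k + \<sigma> * s (n+d) (Suc k))"
      using c_pos[OF lev] by simp
    also have "\<dots> = \<sigma> * (f (?p d (Suc k)) - f (?p d k))"
      unfolding increment[OF lev kb] by (simp add: algebra_simps)
    finally show ?thesis by (simp add: algebra_simps)
  qed
  have dyadic: "\<sigma> * f (?p d a) \<le> \<sigma> * f (?p d b)" if "i*2^d \<le> a" "a \<le> b" "b \<le> j*2^d" for d a b
    using that(2,3)
  proof (induction b rule: dec_induct)
    case (step b)
    then show ?case using inc[of d b] that(1) by simp
  qed simp
  \<comment> \<open>the largest dyadic point of level n + d not exceeding x\<close>
  define fl where "fl = (\<lambda>(x::real) d. nat \<lfloor>x * 2^(n+d)\<rfloor>)"
  have fl: "real (fl x d) \<le> x * 2^(n+d)" "x * 2^(n+d) < real (fl x d) + 1" if "0 \<le> x" for x :: real and d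
    using that by (auto simp: fl_def)
  have fl_bounds: "i*2^d \<le> fl x d" "fl x d \<le> j*2^d" if "real i / 2^n \<le> x" "x \<le> real j / 2^n" for x d
  proof -
    have x0: "0 \<le> x" using that(1) by (rule order_trans[rotated]) simp
    have "real i * 2^d = real i / 2^n * 2^(n+d)" by (simp add: power_add)
    also have "\<dots> \<le> x * 2^(n+d)" using that(1) by (intro mult_right_mono) auto
    finally have "real (i*2^d) < real (fl x d) + 1" using fl(2)[OF x0, of d] by simp
    then show "i*2^d \<le> fl x d" by linarith
    have "x * 2^(n+d) \<le> real j / 2^n * 2^(n+d)" using that(2) by (intro mult_right_mono) auto
    also have "\<dots> = real (j*2^d)" by (simp add: power_add)
    finally show "fl x d \<le> j*2^d" using fl(1)[OF x0, of d] by linarith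
  qed
  have unit: "x \<in> {0..1}" if "real i / 2^n \<le> x" "x \<le> real j / 2^n" for x
  proof -
    have "real j / 2^n \<le> 1" using ij(2) by (simp add: divide_simps flip: of_nat_le_iff)
    moreover have "0 \<le> real i / 2^n" by simp
    ultimately show ?thesis using that by (simp only: atLeastAtMost_iff) linarith
  qed
  have lim: "(\<lambda>d. f (?p d (fl x d))) \<longlonglongrightarrow> f x" if x: "real i / 2^n \<le> x" "x \<le> real j / 2^n" for x
  proof -
    have x0: "0 \<le> x" using unit[OF x] by simp
    have "(\<lambda>d. 1 / 2^n * (1/2)^d) \<longlonglongrightarrow> 1 / 2^n * (0::real)"
      by (intro tendsto_intros) auto
    then have z: "(\<lambda>d. (1::real) / 2^(n+d)) \<longlonglongrightarrow> 0" by (simp add: power_add power_divide)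
    have conv: "(\<lambda>d. ?p d (fl x d)) \<longlonglongrightarrow> x"
    proof (rule LIM_zero_cancel, rule Lim_null_comparison[OF _ z], intro always_eventually allI)
      fix d
      have "?p d (fl x d) - x = (real (fl x d) - x * 2^(n+d)) / 2^(n+d)" by (simp add: diff_divide_distrib)
      then show "norm (?p d (fl x d) - x) \<le> 1 / 2^(n+d)"
        using fl[OF x0, of d] by (simp add: abs_le_iff divide_right_mono)
    qed
    have mem: "?p d (fl x d) \<in> {0..1}" for d
    proof -
      have "fl x d \<le> j*2^d" by (rule fl_bounds[OF x])
      also have "\<dots> \<le> 2^n*2^d" using ij(2) by simp
      finally have "real (fl x d) \<le> real (2^n*2^d)" by (simp only: of_nat_le_iff)
      then have "real (fl x d) \<le> 2^(n+d)" by (simp add: power_add)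
      then show ?thesis by simp
    qed
    show ?thesis
      by (rule continuous_on_tendsto_compose[OF cont conv unit[OF x]]) (simp add: mem[simplified])
  qed
  \<comment> \<open>strictness is lost in the limit and recovered from two dyadic points between x and y\<close>
  have weak: "\<sigma> * f x \<le> \<sigma> * f y" if "real i / 2^n \<le> x" "x \<le> y" "y \<le> real j / 2^n" for x y
  proof (rule LIMSEQ_le)
    show "(\<lambda>d. \<sigma> * f (?p d (fl x d))) \<longlonglongrightarrow> \<sigma> * f x" "(\<lambda>d. \<sigma> * f (?p d (fl y d))) \<longlonglongrightarrow> \<sigma> * f y"
      using that by (auto intro!: tendsto_mult lim)
    have "fl x d \<le> fl y d" for d
      using that(2) by (auto simp: fl_def intro!: nat_mono floor_mono)
    then show "\<exists>N. \<forall>d\<ge>N. \<sigma> * f (?p d (fl x d)) \<le> \<sigma> * f (?p d (fl y d))"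
      using that by (intro exI allI impI dyadic fl_bounds) auto
  qed
  show ?thesis
    unfolding rises_def
  proof (intro allI impI)
    fix x y assume xy: "real i / 2^n \<le> x \<and> x < y \<and> y \<le> real j / 2^n"
    have x0: "0 \<le> x" using unit[of x] xy by simp
    obtain d where d: "2 / (y - x) < 2^d" using real_arch_pow[of 2 "2 / (y - x)"] by auto
    have "2 < 2^d * (y - x)" using d xy by (simp add: field_simps)
    also have "\<dots> \<le> 2^(n+d) * (y - x)" using xy by (intro mult_right_mono) auto
    finally have big: "x * 2^(n+d) + 2 < y * 2^(n+d)" by (simp add: algebra_simps)
    define a where "a = Suc (fl x d)"
    have a: "x * 2^(n+d) \<le> real a" "real (Suc a) \<le> y * 2^(n+d)"
      using fl[OF x0, of d] big by (auto simp: a_def)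
    have "x \<le> ?p d a" "?p d (Suc a) \<le> y" using a by (simp_all add: field_simps)
    moreover have "?p d a < ?p d (Suc a)" by (simp add: divide_strict_right_mono)
    moreover have ab: "i*2^d \<le> a" "a < j*2^d"
    proof -
      show "i*2^d \<le> a" using fl_bounds[of x d] xy by (simp add: a_def)
      have "real (Suc a) \<le> real j / 2^n * 2^(n+d)"
        using a(2) xy by (meson mult_right_mono order_trans zero_le_numeral zero_le_power)
      also have "\<dots> = real (j*2^d)" by (simp add: power_add)
      finally show "a < j*2^d" by linarith
    qed
    ultimately have "\<sigma> * f x \<le> \<sigma> * f (?p d a)" "\<sigma> * f (?p d (Suc a)) \<le> \<sigma> * f y"
      using xy by (auto intro!: weak)
    then show "\<sigma> * f x < \<sigma> * f y" using inc[OF ab] by linarith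
  qed
qed

lemma eventual_neighbour:
  assumes n: "M \<le> n" and \<sigma>: "\<sigma> * s n k > 0"
  shows right_neighbour: "k < 2^n \<Longrightarrow> \<exists>d. 0 \<le> \<sigma> * s (n+d) (k*2^d + 1)"
    and left_neighbour: "0 < k \<Longrightarrow> k \<le> 2^n \<Longrightarrow> \<exists>d. 0 \<le> \<sigma> * s (n+d) (k*2^d - 1)"
proof -
  have old: "\<sigma> * s (n + Suc d) (k*2^Suc d) = g (n+d) * (\<sigma> * s (n+d) (k*2^d))" if "k \<le> 2^n" for d
    using old_slope[of "n+d" "k*2^d"] level[of "n+d"] n that by (simp add: power_add mult_ac)
  show "\<exists>d. 0 \<le> \<sigma> * s (n+d) (k*2^d + 1)" if k: "k < 2^n"
  proof (rule eventually_nonneg_neighbour[where a = "\<lambda>d. \<sigma> * s (n+d) (k*2^d)"])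
    fix d
    show "\<sigma> * s (n + Suc d) (k*2^Suc d + 1) =
          h (n+d) * (\<sigma> * s (n+d) (k*2^d) + \<sigma> * s (n+d) (k*2^d + 1))"
      using new_slope[of "n+d" "k*2^d"] level[of "n+d"] n k
      by (simp add: power_add algebra_simps)
  qed (use old k \<sigma> gh n in auto)
  show "\<exists>d. 0 \<le> \<sigma> * s (n+d) (k*2^d - 1)" if k: "0 < k" "k \<le> 2^n"
  proof (rule eventually_nonneg_neighbour[where a = "\<lambda>d. \<sigma> * s (n+d) (k*2^d)"])
    fix d
    obtain j where j: "k*2^d = Suc j" using k(1) by (metis gr0_implies_Suc mult_pos_pos pos2 zero_less_power)
    have "Suc j \<le> 2^(n+d)" using k(2) by (simp add: power_add flip: j)
    moreover have "k*2^Suc d - 1 = 2*j + 1" using j by simp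
    moreover have "k*2^d - 1 = j" "k*2^d = Suc j" using j by simp_all
    ultimately show "\<sigma> * s (n + Suc d) (k*2^Suc d - 1) =
          h (n+d) * (\<sigma> * s (n+d) (k*2^d) + \<sigma> * s (n+d) (k*2^d - 1))"
      using new_slope[of "n+d" j] level[of "n+d"] n
      by (simp only:) (simp add: algebra_simps)
  qed (use old k \<sigma> gh n in auto)
qed

text \<open>
  A nonzero slope is the direction of \<open>f\<close> near the vertex, on either side: the slope of the neighbouring
  vertex may have the wrong sign at level \<open>n\<close>, but not on all finer levels.
\<close>

lemma rises_near_vertex:
  assumes n: "M \<le> n" and s: "\<sigma> * s n k > 0"
  shows rises_after: "k < 2^n \<Longrightarrow> \<exists>y. real k / 2^n < y \<and> y \<le> real (Suc k) / 2^n \<and> rises \<sigma> f (real k / 2^n) y"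
    and rises_before: "0 < k \<Longrightarrow> k \<le> 2^n \<Longrightarrow>
      \<exists>y. real (k - 1) / 2^n \<le> y \<and> y < real k / 2^n \<and> rises \<sigma> f y (real k / 2^n)"
proof -
  have s0: "\<sigma> \<noteq> 0" using s by auto
  have sk: "0 \<le> \<sigma> * s (n+d) (k*2^d)" if "k \<le> 2^n" for d
    by (rule nonneg_refine[OF n that, of k]) (use s in \<open>auto dest: le_antisym\<close>)
  have pt: "real (k*2^d) / 2^(n+d) = real k / 2^n" for d by (simp add: power_add)
  show "\<exists>y. real k / 2^n < y \<and> y \<le> real (Suc k) / 2^n \<and> rises \<sigma> f (real k / 2^n) y" if k: "k < 2^n"
  proof -
    obtain d where d: "0 \<le> \<sigma> * s (n+d) (k*2^d + 1)" using right_neighbour[OF n s k] by blast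
    have "k*2^d + 1 \<le> Suc k * 2^d" by simp
    also have "\<dots> \<le> 2^(n+d)" using k by (simp add: power_add Suc_leI del: mult_Suc)
    finally have b: "k*2^d + 1 \<le> 2^(n+d)" .
    have "rises \<sigma> f (real (k*2^d) / 2^(n+d)) (real (k*2^d + 1) / 2^(n+d))"
    proof (rule rises_run[OF _ _ b s0])
      fix l assume "k*2^d \<le> l" "l \<le> k*2^d + 1"
      then have "l = k*2^d \<or> l = k*2^d + 1" by linarith
      then show "0 \<le> \<sigma> * s (n+d) l" using sk[of d] d k by auto
    qed (use n in auto)
    moreover have "real (k*2^d + 1) / 2^(n+d) \<le> real (Suc k) / 2^n"
      by (simp add: power_add field_simps)
    moreover have "real (k*2^d) / 2^(n+d) < real (k*2^d + 1) / 2^(n+d)" by (intro divide_strict_right_mono) auto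
    ultimately show ?thesis unfolding pt by blast
  qed
  show "\<exists>y. real (k - 1) / 2^n \<le> y \<and> y < real k / 2^n \<and> rises \<sigma> f y (real k / 2^n)"
    if k: "0 < k" "k \<le> 2^n"
  proof -
    obtain d where d: "0 \<le> \<sigma> * s (n+d) (k*2^d - 1)" using left_neighbour[OF n s k] by blast
    have k1: "1 \<le> k*2^d" using k(1) by simp
    have b: "k*2^d \<le> 2^(n+d)" using k(2) by (simp add: power_add)
    have "rises \<sigma> f (real (k*2^d - 1) / 2^(n+d)) (real (k*2^d) / 2^(n+d))"
    proof (rule rises_run[OF _ _ b s0])
      fix l assume "k*2^d - 1 \<le> l" "l \<le> k*2^d"
      then have "l = k*2^d - 1 \<or> l = k*2^d" by linarith
      then show "0 \<le> \<sigma> * s (n+d) l" using sk[of d] d k by auto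
    qed (use n in auto)
    moreover have "real (k - 1) / 2^n \<le> real (k*2^d - 1) / 2^(n+d)"
      using k k1 by (simp add: power_add field_simps of_nat_diff)
    moreover have "real (k*2^d - 1) / 2^(n+d) < real (k*2^d) / 2^(n+d)"
      using k1 by (intro divide_strict_right_mono) (auto simp: of_nat_diff)
    ultimately show ?thesis unfolding pt by blast
  qed
qed

text \<open>
  Inserting signs between neighbours preserves an antitone sign sequence, so a cell that turns from \<open>\<sigma>\<close>
  to \<open>- \<sigma>\<close> has a single change of sign at every finer level.
\<close>

lemma antitone_refine:
  assumes n: "M \<le> n" and k: "k < 2^n" and t: "\<sigma> * s n k > 0" "\<sigma> * s n (Suc k) < 0"
  shows "k*2^d \<le> p \<Longrightarrow> p < Suc k*2^d \<Longrightarrow> sgn (\<sigma> * s (n+d) (Suc p)) \<le> sgn (\<sigma> * s (n+d) p)"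
proof (induction d arbitrary: p)
  case 0
  then have "p = k" by simp
  then show ?case using t by simp
next
  case (Suc d)
  obtain j where j: "p = 2*j \<or> p = 2*j+1" by (metis oddE evenE)
  then have jb: "k*2^d \<le> j" "j < Suc k*2^d" using Suc.prems by auto
  have "Suc k*2^d \<le> 2^n*2^d" using k by (intro mult_right_mono) auto
  with jb(2) have jm: "j < 2^(n+d)" by (simp only: power_add)
  have lev: "m1 \<le> n+d" "M \<le> n+d" using n level by auto
  have e: "\<sigma> * s (n + Suc d) (2*j) = g (n+d) * (\<sigma> * s (n+d) j)"
    "\<sigma> * s (n + Suc d) (2 * Suc j) = g (n+d) * (\<sigma> * s (n+d) (Suc j))"
    "\<sigma> * s (n + Suc d) (Suc (2*j)) = h (n+d) * (\<sigma> * s (n+d) j + \<sigma> * s (n+d) (Suc j))"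
    using old_slope[OF lev(1), of j] old_slope[OF lev(1), of "Suc j"] new_slope[OF lev(1), of j] jm
    by (simp_all add: algebra_simps)
  note IH = Suc.IH[OF jb]
  show ?case using j
  proof
    assume p: "p = 2*j"
    have "sgn (\<sigma> * s (n+d) j + \<sigma> * s (n+d) (Suc j)) \<le> sgn (\<sigma> * s (n+d) j)"
      using sgn_add_between[OF IH] by simp
    then show ?thesis unfolding p e by (simp only: sgn_scale[OF gh(1)[OF lev(2)]] sgn_scale[OF gh(3)[OF lev(2)]])
  next
    assume p: "p = 2*j+1"
    have "sgn (\<sigma> * s (n+d) (Suc j)) \<le> sgn (\<sigma> * s (n+d) j + \<sigma> * s (n+d) (Suc j))"
      using sgn_add_between[OF IH] by simp
    moreover have "Suc p = 2 * Suc j" "p = Suc (2*j)" using p by auto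
    ultimately show ?thesis by (simp only: e sgn_scale[OF gh(1)[OF lev(2)]] sgn_scale[OF gh(3)[OF lev(2)]])
  qed
qed

text \<open>
  The turning point \<open>t\<close> is the maximum of \<open>\<sigma> f\<close> on the cell.  It is not an end of the cell because
  of the directions of \<open>f\<close> there.  Every dyadic point of the cell ends a rising run from the left or
  starts a falling run to the right; by maximality the former holds for the points left of \<open>t\<close> and
  the latter for those right of \<open>t\<close>.
\<close>

lemma turning_cell:
  assumes k: "k < 2^M" and \<sigma>: "\<sigma> * s M k > 0" "\<sigma> * s M (Suc k) < 0"
  obtains t where "real k / 2^M < t" "t < real (Suc k) / 2^M"
    "rises \<sigma> f (real k / 2^M) t" "rises (- \<sigma>) f t (real (Suc k) / 2^M)"
proof -
  let ?a = "real k / 2^M" and ?b = "real (Suc k) / 2^M"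
  have ab: "0 \<le> ?a" "?a < ?b" by (simp_all add: divide_strict_right_mono)
  have "real (Suc k) \<le> 2^M" using k by (metis Suc_leI of_nat_le_iff of_nat_numeral of_nat_power)
  then have b1: "?b \<le> 1" by simp
  have s0: "\<sigma> \<noteq> 0" "- \<sigma> \<noteq> 0" using \<sigma> by auto
  have "\<exists>t\<in>{?a..?b}. \<forall>x\<in>{?a..?b}. \<sigma> * f x \<le> \<sigma> * f t"
    using ab b1 by (intro continuous_attains_sup continuous_intros continuous_on_subset[OF cont]) auto
  then obtain t where t: "?a \<le> t" "t \<le> ?b" and max: "\<And>x. ?a \<le> x \<Longrightarrow> x \<le> ?b \<Longrightarrow> \<sigma> * f x \<le> \<sigma> * f t"
    by auto
  have pos: "?a < t"
  proof (rule ccontr)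
    assume "\<not> ?a < t"
    then have "t = ?a" using t by simp
    obtain y where "?a < y" "y \<le> ?b" "rises \<sigma> f ?a y" using rises_after[OF order_refl \<sigma>(1) k] by blast
    then show False using risesD[of \<sigma> f ?a y ?a y] max[of y] \<open>t = ?a\<close> by simp
  qed
  have neg: "t < ?b"
  proof (rule ccontr)
    assume "\<not> t < ?b"
    then have "t = ?b" using t by simp
    obtain y where "?a \<le> y" "y < ?b" "rises (- \<sigma>) f y ?b"
      using rises_before[of M "- \<sigma>" "Suc k"] \<sigma>(2) k by auto
    then show False using risesD[of "- \<sigma>" f y ?b y ?b] max[of y] \<open>t = ?b\<close> by simp
  qed
  have runs: "rises \<sigma> f ?a (real p / 2^(M+d)) \<or> rises (- \<sigma>) f (real p / 2^(M+d)) ?b"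
    if p: "?a \<le> real p / 2^(M+d)" "real p / 2^(M+d) \<le> ?b" for p d
  proof -
    have "real (k*2^d) \<le> real p" "real p \<le> real (Suc k*2^d)"
      using p by (simp_all add: power_add field_simps)
    then have pb: "k*2^d \<le> p" "p \<le> Suc k*2^d" by (simp_all only: of_nat_le_iff)
    have "Suc k*2^d \<le> 2^M*2^d" using k by (intro mult_right_mono) auto
    then have kb: "Suc k*2^d \<le> 2^(M+d)" by (simp add: power_add)
    have anti: "sgn (\<sigma> * s (M+d) l) \<le> sgn (\<sigma> * s (M+d) j)"
      if "k*2^d \<le> j" "j \<le> l" "l \<le> Suc k*2^d" for j l
      using that(2,3)
    proof (induction l rule: dec_induct)
      case (step l)
      then show ?case
        using antitone_refine[OF order_refl k \<sigma>, of d l] that(1) by simp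
    qed simp
    show ?thesis
    proof (cases "0 \<le> \<sigma> * s (M+d) p")
      case True
      have "0 \<le> \<sigma> * s (M+d) j" if "k*2^d \<le> j" "j \<le> p" for j
        using anti[OF that pb(2)] True by (auto simp: sgn_if split: if_splits)
      then have "rises \<sigma> f (real (k*2^d) / 2^(M+d)) (real p / 2^(M+d))"
        using pb kb s0 by (intro rises_run) auto
      then show ?thesis by (simp add: power_add)
    next
      case False
      have "0 \<le> - \<sigma> * s (M+d) j" if "p \<le> j" "j \<le> Suc k*2^d" for j
        using anti[OF pb(1) that] False by (auto simp: sgn_if split: if_splits)
      then have "rises (- \<sigma>) f (real p / 2^(M+d)) (real (Suc k*2^d) / 2^(M+d))"
        using pb kb s0 by (intro rises_run) auto
      moreover have "real (Suc k*2^d) / 2^(M+d) = ?b" by (simp add: power_add field_simps)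
      ultimately show ?thesis by simp
    qed
  qed
  have up: "\<sigma> * f x < \<sigma> * f y" if xy: "?a \<le> x" "x < y" "y < t" for x y
  proof -
    obtain d p where p: "y < real p / 2^(M+d)" "real p / 2^(M+d) < t"
      using dyadic_between[of y t M] xy ab by (metis le_less_trans less_imp_le)
    have "\<not> rises (- \<sigma>) f (real p / 2^(M+d)) ?b"
      using risesD[of "- \<sigma>" f "real p / 2^(M+d)" ?b "real p / 2^(M+d)" t] p t max[of "real p / 2^(M+d)"] xy
      by auto
    then have "rises \<sigma> f ?a (real p / 2^(M+d))" using runs[of p d] p xy t by linarith
    then show ?thesis using risesD[of \<sigma> f ?a "real p / 2^(M+d)" x y] xy p by simp
  qed
  have down: "\<sigma> * f y < \<sigma> * f x" if xy: "t < x" "x < y" "y \<le> ?b" for x y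
  proof -
    obtain d p where p: "t < real p / 2^(M+d)" "real p / 2^(M+d) < x"
      using dyadic_between[of t x M] xy ab t by (metis order_trans)
    have "\<not> rises \<sigma> f ?a (real p / 2^(M+d))"
      using risesD[of \<sigma> f ?a "real p / 2^(M+d)" t "real p / 2^(M+d)"] p t max[of "real p / 2^(M+d)"] xy
      by auto
    then have "rises (- \<sigma>) f (real p / 2^(M+d)) ?b" using runs[of p d] p xy t by linarith
    then show ?thesis using risesD[of "- \<sigma>" f "real p / 2^(M+d)" ?b x y] xy p by simp
  qed
  have "rises \<sigma> f ?a t"
    unfolding rises_def
  proof (intro allI impI)
    fix x y assume xy: "?a \<le> x \<and> x < y \<and> y \<le> t"
    show "\<sigma> * f x < \<sigma> * f y"
    proof (cases "y = t")
      case True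
      have "?a \<le> x" "x < y" "y \<le> ?b" using xy t by auto
      note mid = max[OF average_between[OF this]]
      have "\<sigma> * f x < \<sigma> * f ((x + y) / 2)" using up[of x "(x+y)/2"] xy True by simp
      also have "\<dots> \<le> \<sigma> * f y" using mid True by simp
      finally show ?thesis .
    qed (use up xy in auto)
  qed
  moreover have "rises (- \<sigma>) f t ?b"
    unfolding rises_def
  proof (intro allI impI)
    fix x y assume xy: "t \<le> x \<and> x < y \<and> y \<le> ?b"
    show "- \<sigma> * f x < - \<sigma> * f y"
    proof (cases "x = t")
      case True
      have "?a \<le> x" "x < y" "y \<le> ?b" using xy t by auto
      note mid = max[OF average_between[OF this]]
      have "\<sigma> * f y < \<sigma> * f ((x + y) / 2)" using down[of "(x+y)/2" y] xy True by simp
      also have "\<dots> \<le> \<sigma> * f x" using mid True by simp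
      finally show ?thesis by simp
    qed (use down xy in auto)
  qed
  ultimately show ?thesis using that pos neg by blast
qed

lemma rises_cell:
  assumes "k < 2^M" "\<sigma> \<noteq> 0" "0 \<le> \<sigma> * s M k" "0 \<le> \<sigma> * s M (Suc k)"
  shows "rises \<sigma> f (real k / 2^M) (real (Suc k) / 2^M)"
proof (rule rises_run)
  fix l assume "k \<le> l" "l \<le> Suc k"
  then have "l = k \<or> l = Suc k" by linarith
  then show "0 \<le> \<sigma> * s M l" using assms by auto
qed (use assms in auto)

lemma extrema_in_cell:
  assumes k: "k < 2^M"
  defines "E \<equiv> interior_extrema f \<inter> {real k / 2^M<..<real (Suc k) / 2^M}"
  shows "finite E \<and> card E = of_bool (s M k * s M (Suc k) < 0)"
proof -
  have "real (Suc k) \<le> 2^M" using k by (metis Suc_leI of_nat_le_iff of_nat_numeral of_nat_power)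
  then have b: "0 \<le> real k / 2^M" "real (Suc k) / 2^M \<le> 1" by simp_all
  show ?thesis
  proof (cases "s M k * s M (Suc k) < 0")
    case True
    define \<sigma> where "\<sigma> = sgn (s M k)"
    have \<sigma>: "\<sigma> * s M k > 0" "\<sigma> * s M (Suc k) < 0"
      using True by (auto simp: \<sigma>_def sgn_if mult_less_0_iff split: if_splits)
    obtain t where t: "real k / 2^M < t" "t < real (Suc k) / 2^M"
      "rises \<sigma> f (real k / 2^M) t" "rises (- \<sigma>) f t (real (Suc k) / 2^M)"
      by (rule turning_cell[OF k \<sigma>])
    have t01: "0 \<le> t" "t \<le> 1" using t b by linarith+
    have "t \<in> interior_extrema f"
      by (rule peak_extremum[OF t(3,4)]) (use t b \<sigma> in auto)
    with t(1,2) have "t \<in> E" unfolding E_def by simp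
    moreover have "x = t" if "x \<in> E" for x
    proof (rule ccontr)
      assume "x \<noteq> t"
      have x: "real k / 2^M < x" "x < real (Suc k) / 2^M" "x \<in> interior_extrema f"
        using that unfolding E_def by auto
      consider "x < t" | "t < x" using \<open>x \<noteq> t\<close> by linarith
      then show False
      proof cases
        case 1
        show False using rises_not_extremum[OF t(3) x(1) 1 b(1) t01(2)] x(3) by contradiction
      next
        case 2
        show False using rises_not_extremum[OF t(4) 2 x(2) t01(1) b(2)] x(3) by contradiction
      qed
    qed
    ultimately have "E = {t}" by blast
    then show ?thesis using True by simp
  next
    case False
    have "0 \<le> s M k \<and> 0 \<le> s M (Suc k) \<or> s M k \<le> 0 \<and> s M (Suc k) \<le> 0"
      using False unfolding mult_less_0_iff by linarith
    then have "0 \<le> 1 * s M k \<and> 0 \<le> 1 * s M (Suc k) \<or> 0 \<le> -1 * s M k \<and> 0 \<le> -1 * s M (Suc k)"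
      by simp
    moreover have "(1::real) \<noteq> 0" "(-1::real) \<noteq> 0" by simp_all
    ultimately obtain \<sigma> where \<sigma>: "\<sigma> \<noteq> 0" "0 \<le> \<sigma> * s M k" "0 \<le> \<sigma> * s M (Suc k)" by blast
    have "x \<notin> interior_extrema f" if "x \<in> {real k / 2^M<..<real (Suc k) / 2^M}" for x
    proof -
      have x: "real k / 2^M < x" "x < real (Suc k) / 2^M"
        using that by (simp_all only: greaterThanLessThan_iff)
      show ?thesis by (rule rises_not_extremum[OF rises_cell[OF k \<sigma>] x b])
    qed
    then have "E = {}" unfolding E_def by blast
    then show ?thesis using False by simp
  qed
qed

lemma vertex_extremum:
  assumes k: "0 < k" "k < 2^M"
  shows "real k / 2^M \<in> interior_extrema f \<longleftrightarrow> s M k = 0"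
proof -
  obtain j where j: "k = Suc j" using k(1) by (cases k) auto
  have "real (Suc k) \<le> 2^M" using k by (metis Suc_leI of_nat_le_iff of_nat_numeral of_nat_power)
  then have b: "0 \<le> real j / 2^M" "real j / 2^M < real k / 2^M" "real k / 2^M < real (Suc k) / 2^M"
    "real (Suc k) / 2^M \<le> 1"
    by (simp_all add: j divide_strict_right_mono)
  show ?thesis
  proof
    assume z: "s M k = 0"
    then have fl: "s M j * s M (Suc k) < 0"
      using zero_flank[OF level[OF order_refl], of j] k j by simp
    define \<sigma> where "\<sigma> = sgn (s M j)"
    have \<sigma>: "\<sigma> * s M j > 0" "\<sigma> * s M (Suc k) < 0" "\<sigma> \<noteq> 0"
      using fl by (auto simp: \<sigma>_def sgn_if mult_less_0_iff split: if_splits)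
    show "real k / 2^M \<in> interior_extrema f"
    proof (rule peak_extremum)
      show "rises \<sigma> f (real j / 2^M) (real k / 2^M)"
        using rises_cell[of j \<sigma>] \<sigma> z k unfolding j by auto
      show "rises (- \<sigma>) f (real k / 2^M) (real (Suc k) / 2^M)"
        using rises_cell[of k "- \<sigma>"] \<sigma> z k by auto
    qed (use b \<sigma> in auto)
  next
    assume ext: "real k / 2^M \<in> interior_extrema f"
    show "s M k = 0"
    proof (rule ccontr)
      assume "s M k \<noteq> 0"
      then have \<sigma>: "sgn (s M k) * s M k > 0" by (auto simp: sgn_if)
      obtain y where y: "real k / 2^M < y" "y \<le> real (Suc k) / 2^M"
        "rises (sgn (s M k)) f (real k / 2^M) y"
        using rises_after[OF order_refl \<sigma> k(2)] by blast
      obtain x where x: "real (k - 1) / 2^M \<le> x" "x < real k / 2^M"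
        "rises (sgn (s M k)) f x (real k / 2^M)"
        using rises_before[OF order_refl \<sigma> k(1)] k(2) by auto
      have "real j / 2^M \<le> x" using x(1) j by simp
      then have "0 \<le> x" "y \<le> 1" using y(2) b(1,4) by linarith+
      then show False
        using rises_not_extremum[OF rises_join[OF x(3) y(3)] x(2) y(1)] ext by simp
    qed
  qed
qed

text \<open>
  Each cell, taken with its left vertex, contributes half of its jump of signs, corrected by half of the
  difference of \<open>z\<close> at its two vertices, where \<open>z\<close> indicates zero slopes.  These corrections telescope.
  The left end of the edge is not an admissible place for an extremum, hence the special role of
  the first cell.
\<close>

theorem card_interior_extrema:
  "2 * real (card (interior_extrema f)) =
     variation M - of_bool (s m1 0 = 0) - of_bool (s m1 (2^m1) = 0)"
proof -
  let ?C = "\<lambda>k. interior_extrema f \<inter> {real k / 2^M..<real (Suc k) / 2^M}"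
  define z where "z = (\<lambda>k. of_bool (s M k = 0) :: real)"
  have cell: "finite (?C k) \<and> 2 * real (card (?C k)) =
      \<bar>sgn (s M k) - sgn (s M (Suc k))\<bar> + z k - z (Suc k) - (if k = 0 then 2 * z 0 else 0)"
    if k: "k < 2^M" for k
  proof -
    let ?E = "interior_extrema f \<inter> {real k / 2^M<..<real (Suc k) / 2^M}"
    let ?V = "interior_extrema f \<inter> {real k / 2^M}"
    have E: "finite ?E" "card ?E = of_bool (s M k * s M (Suc k) < 0)"
      using extrema_in_cell[OF k] by auto
    have "card ?V = of_bool (0 < k \<and> s M k = 0)"
    proof (cases "k = 0")
      case True
      then show ?thesis by (auto simp: interior_extrema_def)
    next
      case False
      then show ?thesis using vertex_extremum[of k] k by auto
    qed
    moreover have C: "?C k = ?E \<union> ?V" by (auto simp: divide_strict_right_mono)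
    moreover have "card (?E \<union> ?V) = card ?E + card ?V"
      using E by (intro card_Un_disjoint) auto
    ultimately have "card (?C k) = of_bool (s M k * s M (Suc k) < 0) + of_bool (0 < k \<and> s M k = 0)"
      using E by simp
    moreover have "finite (?C k)" unfolding C using E by simp
    ultimately show ?thesis
      using adjacent_nonzero[OF level[OF order_refl] k]
      by (cases "s M k" "0::real" rule: linorder_cases; cases "s M (Suc k)" "0::real" rule: linorder_cases)
         (auto simp: z_def sgn_if mult_less_0_iff not_less)
  qed
  have "interior_extrema f = interior_extrema f \<inter> {0..<1}" by (auto simp: interior_extrema_def)
  also have "\<dots> = (\<Union>k<2^M. ?C k)" unfolding unit_interval_cells[of M] by blast
  finally have split: "interior_extrema f = (\<Union>k<2^M. ?C k)" .
  have disj: "?C k \<inter> ?C l = {}" if "k < l" for k l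
  proof -
    have "real (Suc k) / 2^M \<le> real l / 2^M" using that by (intro divide_right_mono) auto
    then show ?thesis by auto
  qed
  have "card (\<Union>k<2^M. ?C k) = (\<Sum>k<2^M. card (?C k))"
  proof (rule card_UN_disjoint)
    show "\<forall>k\<in>{..<2^M}. \<forall>l\<in>{..<2^M}. k \<noteq> l \<longrightarrow> ?C k \<inter> ?C l = {}"
      using disj by (metis inf_commute linorder_neq_iff)
  qed (use cell in auto)
  then have "2 * real (card (interior_extrema f)) = (\<Sum>k<2^M. 2 * real (card (?C k)))"
    using split by (simp add: sum_distrib_left)
  also have "\<dots> = (\<Sum>k<2^M. \<bar>sgn (s M k) - sgn (s M (Suc k))\<bar> - (z (Suc k) - z k) - (if k = 0 then 2 * z 0 else 0))"
    using cell by (intro sum.cong) auto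
  also have "\<dots> = variation M - (\<Sum>k<2^M. z (Suc k) - z k) - (\<Sum>k<2^M::nat. if k = 0 then 2 * z 0 else 0)"
    by (simp only: sum_subtractf variation_def)
  also have "\<dots> = variation M - (z (2^M) - z 0) - 2 * z 0"
    by (simp only: sum_lessThan_telescope) simp
  also have "\<dots> = variation M - z 0 - z (2^M)" by simp
  finally show ?thesis
    using start_zero_iff[OF M] by (simp add: z_def)
qed

end

section \<open>Spectral decimation along an edge\<close>

definition edge_point :: "(3 \<Rightarrow> real^2) \<Rightarrow> 3 \<Rightarrow> 3 \<Rightarrow> real \<Rightarrow> real^2" where
  "edge_point q i j t = (1 - t) *\<^sub>R q i + t *\<^sub>R q j"

text \<open>
  The address of the \<open>n\<close>-th cell of level \<open>m\<close> along the edge from \<open>q i\<close> to \<open>q j\<close>: the binary digits of \<open>n\<close>,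
  most significant first, with \<open>i\<close> for \<open>0\<close> and \<open>j\<close> for \<open>1\<close>.
\<close>

primrec edge_word :: "3 \<Rightarrow> 3 \<Rightarrow> nat \<Rightarrow> nat \<Rightarrow> 3 list" where
  "edge_word i j 0 n = []"
| "edge_word i j (Suc m) n = edge_word i j m (n div 2) @ [if even n then i else j]"

lemma length_edge_word [simp]: "length (edge_word i j m n) = m"
  by (induction m arbitrary: n) auto

lemma UNIV_triple: "distinct [i, j, k] \<Longrightarrow> (UNIV :: 3 set) = {i, j, k}"
  by (rule card_eq_UNIV_imp_eq_UNIV[symmetric]) auto

lemma Fw_Nil [simp]: "Fw q [] x = x"
  and Fw_Cons [simp]: "Fw q (a # w) x = F q a (Fw q w x)"
  and Fw_snoc: "Fw q (w @ [a]) x = Fw q w (F q a x)"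
  by (simp_all add: Fw_def)

lemma F_vertex: "F q a (q b) = midpoint (q a) (q b)"
  by (vector F_def midpoint_def) (simp add: field_simps)

lemma F_midpoint: "F q a (midpoint x y) = midpoint (F q a x) (F q a y)"
  by (vector F_def midpoint_def) (simp add: field_simps)

lemma Fw_midpoint: "Fw q w (midpoint x y) = midpoint (Fw q w x) (Fw q w y)"
  by (induction w) (simp_all add: F_midpoint)

lemma Fw_edge_word:
  "n < 2^m \<Longrightarrow> Fw q (edge_word i j m n) x =
     (1 / 2^m) *\<^sub>R x + ((2^m - 1 - real n) / 2^m) *\<^sub>R q i + (real n / 2^m) *\<^sub>R q j"
proof (induction m arbitrary: n x)
  case (Suc m)
  obtain l where l: "n = 2*l \<or> n = 2*l+1" by (metis oddE evenE)
  then have lb: "l < 2^m" and d: "n div 2 = l" using Suc.prems by auto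
  show ?case using l
    by (auto simp: Fw_snoc Suc.IH[OF lb] d F_def vec_eq_iff field_simps)
qed simp

lemma Fw_edge_word_vertices:
  assumes "n < 2^m"
  shows "Fw q (edge_word i j m n) (q i) = edge_point q i j (real n / 2^m)"
    and "Fw q (edge_word i j m n) (q j) = edge_point q i j (real (Suc n) / 2^m)"
proof -
  have c: "1 / 2^m + (2^m - 1 - real n) / 2^m = 1 - real n / 2^m"
    "(2^m - 1 - real n) / 2^m = 1 - real (Suc n) / 2^m" "1 / 2^m + real n / 2^m = real (Suc n) / 2^m"
    by (simp_all add: diff_divide_distrib add_divide_distrib)
  show "Fw q (edge_word i j m n) (q i) = edge_point q i j (real n / 2^m)"
    by (simp only: Fw_edge_word[OF assms] edge_point_def c(1) flip: scaleR_left_distrib)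
  show "Fw q (edge_word i j m n) (q j) = edge_point q i j (real (Suc n) / 2^m)"
    unfolding Fw_edge_word[OF assms] edge_point_def c(2) c(3)[symmetric] scaleR_left_distrib
    by (simp only: add_ac)
qed

lemma edge_point_dist: "dist (edge_point q i j s) (edge_point q i j t) = \<bar>s - t\<bar> * dist (q i) (q j)"
proof -
  have "edge_point q i j s - edge_point q i j t = (s - t) *\<^sub>R (q j - q i)"
    by (simp add: edge_point_def algebra_simps)
  then show ?thesis by (simp add: dist_norm norm_minus_commute)
qed

lemma card_edge_extrema:
  assumes ne: "q i \<noteq> q j"
  shows "card (edge_extrema (q i) (q j) u) = card (interior_extrema (\<lambda>t. u (edge_point q i j t)))"
proof -
  let ?P = "edge_point q i j" and ?D = "dist (q i) (q j)"
  have D: "?D > 0" using ne by simp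
  have inj: "inj ?P"
    by (rule injI) (metis D abs_eq_0 dist_eq_0_iff edge_point_dist eq_iff_diff_eq_0 less_irrefl mult_eq_0_iff)
  have op: "open_segment (q i) (q j) = ?P ` {0<..<1}"
    using open_segment_image_interval[of "q i" "q j"] ne by (simp add: edge_point_def[abs_def])
  have cl: "closed_segment (q i) (q j) = ?P ` {0..1}"
    using closed_segment_image_interval[of "q i" "q j"] by (simp add: edge_point_def[abs_def])
  have scale: "(\<exists>e>0. (\<forall>y\<in>?P ` {0..1}. dist y (?P x) < e \<longrightarrow> R y) \<or> (\<forall>y\<in>?P ` {0..1}. dist y (?P x) < e \<longrightarrow> S y))
     \<longleftrightarrow> (\<exists>e>0. (\<forall>y\<in>{0..1}. dist y x < e \<longrightarrow> R (?P y)) \<or> (\<forall>y\<in>{0..1}. dist y x < e \<longrightarrow> S (?P y)))"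
    (is "?L \<longleftrightarrow> ?R") for R S x
  proof
    assume ?L
    then obtain e where e: "e > 0" "(\<forall>y\<in>?P ` {0..1}. dist y (?P x) < e \<longrightarrow> R y) \<or> (\<forall>y\<in>?P ` {0..1}. dist y (?P x) < e \<longrightarrow> S y)"
      by blast
    have "dist (?P y) (?P x) < e" if "dist y x < e / ?D" for y
      using that D by (simp add: edge_point_dist dist_real_def field_simps)
    then show ?R using e D by (intro exI[of _ "e / ?D"]) auto
  next
    assume ?R
    then obtain e where e: "e > 0" "(\<forall>y\<in>{0..1}. dist y x < e \<longrightarrow> R (?P y)) \<or> (\<forall>y\<in>{0..1}. dist y x < e \<longrightarrow> S (?P y))"
      by blast
    have "dist y x < e" if "dist (?P y) (?P x) < e * ?D" for y
      using that D by (simp add: edge_point_dist dist_real_def)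
    then show ?L using e D by (intro exI[of _ "e * ?D"]) auto
  qed
  have "?P t \<in> edge_extrema (q i) (q j) u \<longleftrightarrow> t \<in> interior_extrema (\<lambda>t. u (?P t))" for t
    unfolding edge_extrema_def interior_extrema_def op cl mem_Collect_eq scale inj_image_mem_iff[OF inj]
    by (rule refl)
  moreover have "edge_extrema (q i) (q j) u \<subseteq> range ?P"
    unfolding edge_extrema_def op by blast
  ultimately have "edge_extrema (q i) (q j) u = ?P ` interior_extrema (\<lambda>t. u (?P t))" by blast
  then show ?thesis by (simp add: card_image inj_on_subset[OF inj])
qed

text \<open>
  The segment is covered by its images under two of the three contractions.  So the largest distance of
  its points from the gasket is at most half of itself.
\<close>

lemma edge_subset_SG: "closed_segment (q i) (q j) \<subseteq> SG q"
proof -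
  let ?K = "closed_segment (q i) (q j)"
  have SG: "compact (SG q)" "SG q \<noteq> {}" "SG q = (\<Union>i. F q i ` SG q)"
    using SG_attractor[of q] by auto
  have cover: "\<exists>a. \<exists>y\<in>?K. x = F q a y" if x: "x \<in> ?K" for x
  proof -
    obtain t where t: "x = (1 - t) *\<^sub>R q i + t *\<^sub>R q j" "0 \<le> t" "t \<le> 1"
      using x unfolding closed_segment_def by blast
    show ?thesis
    proof (cases "t \<le> 1/2")
      case True
      have "x = F q i ((1 - 2*t) *\<^sub>R q i + (2*t) *\<^sub>R q j)"
        unfolding t(1) by (vector F_def) (simp add: field_simps)
      moreover have "0 \<le> 2*t" "2*t \<le> 1" using True t by auto
      ultimately show ?thesis unfolding closed_segment_def by blast
    next
      case False
      have "x = F q j ((1 - (2*t - 1)) *\<^sub>R q i + (2*t - 1) *\<^sub>R q j)"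
        unfolding t(1) by (vector F_def) (simp add: field_simps)
      moreover have "0 \<le> 2*t - 1" "2*t - 1 \<le> 1" using False t by auto
      ultimately show ?thesis unfolding closed_segment_def by blast
    qed
  qed
  obtain x where x: "x \<in> ?K" "\<And>y. y \<in> ?K \<Longrightarrow> infdist y (SG q) \<le> infdist x (SG q)"
    using continuous_attains_sup[of ?K "\<lambda>x. infdist x (SG q)"]
      continuous_on_infdist[OF continuous_on_id, of ?K "SG q"] by auto
  obtain a y where y: "y \<in> ?K" "x = F q a y" using cover[OF x(1)] by blast
  obtain z where z: "z \<in> SG q" "infdist y (SG q) = dist y z"
    using infdist_attains_inf[OF compact_imp_closed[OF SG(1)] SG(2)] by blast
  have "F q a z \<in> SG q" using SG(3) z(1) by blast
  then have "infdist x (SG q) \<le> dist (F q a y) (F q a z)" unfolding y(2) by (rule infdist_le)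
  also have "\<dots> \<le> infdist x (SG q) / 2" using x(2)[OF y(1)] z(2) by (simp add: F_dist)
  finally have "infdist x (SG q) \<le> 0" by simp
  then have "infdist y (SG q) = 0" if "y \<in> ?K" for y
    using x(2)[OF that] infdist_nonneg[of y "SG q"] by linarith
  then show ?thesis
    using in_closed_iff_infdist_zero[OF compact_imp_closed[OF SG(1)] SG(2)] by blast
qed

text \<open>
  The two identities behind the refinement of slopes, on a cell with vertex values \<open>a\<close>, \<open>b\<close>, \<open>c\<close>.  The
  first one compares the normal derivative at an old vertex before and after the step.  The second one
  gives the normal derivative at a new midpoint, where \<open>c\<close> cancels, so that only the increment
  of the function along the edge remains.
\<close>

lemma decimation_algebra:
  fixes a b c l :: real
  assumes l: "l \<noteq> 2" "l \<noteq> 5"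
  defines "D \<equiv> (2 - l) * (5 - l)" and "x \<equiv> l * (5 - l)"
  defines "mid \<equiv> ((4 - l) * (a + b) + 2 * c) / D" and "L \<equiv> ((4 - l) * (a + c) + 2 * b) / D"
  shows "mid + L - (2 - l/2) * a = (6 - l) / D * (b + c - (2 - x/2) * a)"
    and "a + L - (2 - l/2) * mid = (6 - l) / (2 * (5 - l)) * (a - b)"
proof -
  have D: "2 - l \<noteq> 0" "5 - l \<noteq> 0" using l by auto
  show "mid + L - (2 - l/2) * a = (6 - l) / D * (b + c - (2 - x/2) * a)"
    unfolding mid_def L_def D_def x_def using D by (simp add: divide_simps) (simp add: algebra_simps)
  show "a + L - (2 - l/2) * mid = (6 - l) / (2 * (5 - l)) * (a - b)"
    unfolding mid_def L_def D_def using D by (simp add: divide_simps) (simp add: algebra_simps)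
qed

lemma decimation_step:
  fixes x e :: real
  assumes x: "0 < x" "x \<le> 6" and e: "e = 1 \<or> e = -1" "x = 6 \<Longrightarrow> e = 1"
  defines "l \<equiv> (5 + e * sqrt (25 - 4 * x)) / 2"
  shows "x = l * (5 - l)" "0 < l" "l < 5" "e = -1 \<Longrightarrow> l < 2" "e = 1 \<Longrightarrow> 3 \<le> l"
    "e = 1 \<Longrightarrow> x < 6 \<Longrightarrow> 3 < l"
proof -
  define r where "r = sqrt (25 - 4 * x)"
  have l: "l = (5 + e * r) / 2" by (simp add: l_def r_def)
  have sq: "r * r = 25 - 4 * x" using x by (simp add: r_def)
  have e2: "e * e = 1" using e by auto
  have "l * (5 - l) = (25 - (e * e) * (r * r)) / 4" unfolding l by (simp add: field_simps)
  then show "x = l * (5 - l)" unfolding sq e2 by simp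
  have r1: "1 \<le> r" unfolding r_def using x by (intro real_le_rsqrt) simp
  have r5: "r < 5" unfolding r_def using x by (intro real_less_lsqrt) auto
  have r1': "1 < r" if "x < 6" unfolding r_def using that by (intro real_less_rsqrt) simp
  show "0 < l" "l < 5" using e(1) r1 r5 by (auto simp: l)
  show "l < 2" if "e = -1" using that e r1' x by (force simp: l)
  show "3 \<le> l" if "e = 1" using that r1 by (simp add: l)
  show "3 < l" if "e = 1" "x < 6" using that r1' by (simp add: l)
qed

text \<open>
  An eigenfunction seen along the edge from \<open>q i\<close> to \<open>q j\<close>, with \<open>q k\<close> the vertex off the edge.  The
  value \<open>6\<close> is admitted at the starting level because the sign \<open>1\<close> leads from \<open>6\<close> to \<open>3\<close>, whereas
  the sign \<open>-1\<close> would lead to the forbidden value \<open>2\<close>.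
\<close>

locale edge_decimation =
  fixes q :: "3 \<Rightarrow> real^2" and u :: "real^2 \<Rightarrow> real" and lam \<epsilon> :: "nat \<Rightarrow> real" and m0 :: nat
    and i j k :: 3
  assumes ijk: "distinct [i, j, k]"
    and cont_u: "continuous_on (SG q) u"
    and rule: "\<And>w a b c. m0 \<le> length w \<Longrightarrow> distinct [a, b, c] \<Longrightarrow>
        u (midpoint (Fw q w (q a)) (Fw q w (q b))) =
          ((4 - lam (Suc (length w))) * (u (Fw q w (q a)) + u (Fw q w (q b))) + 2 * u (Fw q w (q c)))
          / ((2 - lam (Suc (length w))) * (5 - lam (Suc (length w))))"
    and lam_Suc: "\<And>m. m0 \<le> m \<Longrightarrow> lam (Suc m) = (5 + \<epsilon> (Suc m) * sqrt (25 - 4 * lam m)) / 2"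
    and signs: "\<And>m. m0 \<le> m \<Longrightarrow> \<epsilon> (Suc m) = 1 \<or> \<epsilon> (Suc m) = -1"
    and lam_start: "0 < lam m0" "lam m0 \<le> 6" "lam m0 = 6 \<Longrightarrow> \<epsilon> (Suc m0) = 1"
begin

lemma lam_range: "m0 \<le> m \<Longrightarrow> 0 < lam m \<and> lam m \<le> 6 \<and> (lam m = 6 \<longrightarrow> \<epsilon> (Suc m) = 1)"
proof (induction m rule: dec_induct)
  case base
  show ?case using lam_start by simp
next
  case (step m)
  then have "0 < lam (Suc m)" "lam (Suc m) < 5"
    using decimation_step(2,3)[of "lam m" "\<epsilon> (Suc m)"] signs[of m] lam_Suc[of m] by auto
  then show ?case by simp
qed

lemma lam_step:
  assumes "m0 \<le> m"
  shows "lam m = lam (Suc m) * (5 - lam (Suc m))" "0 < lam (Suc m)" "lam (Suc m) < 5"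
    "\<epsilon> (Suc m) = -1 \<Longrightarrow> lam (Suc m) < 2" "\<epsilon> (Suc m) = 1 \<Longrightarrow> 3 \<le> lam (Suc m)"
    "\<epsilon> (Suc m) = 1 \<Longrightarrow> lam m < 6 \<Longrightarrow> 3 < lam (Suc m)" "lam (Suc m) \<noteq> 2" "lam (Suc m) \<noteq> 5"
proof -
  note r = lam_range[OF assms] and s = signs[OF assms]
  note d = decimation_step[of "lam m" "\<epsilon> (Suc m)", folded lam_Suc[OF assms]]
  show "lam m = lam (Suc m) * (5 - lam (Suc m))" "0 < lam (Suc m)" "lam (Suc m) < 5"
    "\<epsilon> (Suc m) = -1 \<Longrightarrow> lam (Suc m) < 2" "\<epsilon> (Suc m) = 1 \<Longrightarrow> 3 \<le> lam (Suc m)"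
    "\<epsilon> (Suc m) = 1 \<Longrightarrow> lam m < 6 \<Longrightarrow> 3 < lam (Suc m)"
    using d r s by auto
  then show "lam (Suc m) \<noteq> 2" "lam (Suc m) \<noteq> 5" using s by fastforce+
qed

definition val :: "nat \<Rightarrow> nat \<Rightarrow> real" where
  "val m n = u (edge_point q i j (real n / 2^m))"

definition opp :: "nat \<Rightarrow> nat \<Rightarrow> real" where
  "opp m n = u (Fw q (edge_word i j m n) (q k))"

lemma refine_values:
  assumes m: "m0 \<le> m" and n: "n < 2^m"
  defines "l \<equiv> lam (Suc m)"
  shows "val (Suc m) (2*n) = val m n" "val (Suc m) (Suc (Suc (2*n))) = val m (Suc n)"
    "val (Suc m) (Suc (2*n)) = ((4 - l) * (val m n + val m (Suc n)) + 2 * opp m n) / ((2 - l) * (5 - l))"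
    "opp (Suc m) (2*n) = ((4 - l) * (val m n + opp m n) + 2 * val m (Suc n)) / ((2 - l) * (5 - l))"
    "opp (Suc m) (Suc (2*n)) = ((4 - l) * (val m (Suc n) + opp m n) + 2 * val m n) / ((2 - l) * (5 - l))"
proof -
  let ?w = "edge_word i j m n"
  have w: "u (Fw q ?w (q i)) = val m n" "u (Fw q ?w (q j)) = val m (Suc n)" "u (Fw q ?w (q k)) = opp m n"
    by (simp_all add: val_def opp_def Fw_edge_word_vertices[OF n])
  show "val (Suc m) (2*n) = val m n" by (simp add: val_def)
  have "real (Suc (Suc (2*n))) / 2^Suc m = real (Suc n) / 2^m" by (simp add: field_simps)
  then show "val (Suc m) (Suc (Suc (2*n))) = val m (Suc n)" by (simp only: val_def)
  have r: "u (Fw q ?w (midpoint (q a) (q b))) =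
      ((4 - l) * (u (Fw q ?w (q a)) + u (Fw q ?w (q b))) + 2 * u (Fw q ?w (q c))) / ((2 - l) * (5 - l))"
    if "distinct [a, b, c]" for a b c
    using rule[of ?w a b c] m that by (simp add: Fw_midpoint l_def)
  have "val (Suc m) (Suc (2*n)) = u (Fw q (edge_word i j (Suc m) (2*n)) (q j))"
    using n by (subst Fw_edge_word_vertices) (auto simp: val_def)
  also have "\<dots> = u (Fw q ?w (midpoint (q i) (q j)))" by (simp add: Fw_snoc F_vertex)
  finally show "val (Suc m) (Suc (2*n)) = ((4 - l) * (val m n + val m (Suc n)) + 2 * opp m n) / ((2 - l) * (5 - l))"
    using r[of i j k] ijk w by simp
  have "opp (Suc m) (2*n) = u (Fw q ?w (midpoint (q i) (q k)))" by (simp add: opp_def Fw_snoc F_vertex)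
  then show "opp (Suc m) (2*n) = ((4 - l) * (val m n + opp m n) + 2 * val m (Suc n)) / ((2 - l) * (5 - l))"
    using r[of i k j] ijk w by auto
  have "opp (Suc m) (Suc (2*n)) = u (Fw q ?w (midpoint (q j) (q k)))" by (simp add: opp_def Fw_snoc F_vertex)
  then show "opp (Suc m) (Suc (2*n)) = ((4 - l) * (val m (Suc n) + opp m n) + 2 * val m n) / ((2 - l) * (5 - l))"
    using r[of j k i] ijk w by auto
qed

text \<open>
  The slopes of a cell at its two vertices on the edge, both oriented from \<open>q i\<close> to \<open>q j\<close>.
\<close>

definition left_slope :: "nat \<Rightarrow> nat \<Rightarrow> real" where
  "left_slope m n = val m (Suc n) + opp m n - (2 - lam m / 2) * val m n"

definition right_slope :: "nat \<Rightarrow> nat \<Rightarrow> real" where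
  "right_slope m n = (2 - lam m / 2) * val m (Suc n) - val m n - opp m n"

lemma refine_slopes:
  assumes m: "m0 \<le> m" and n: "n < 2^m"
  defines "l \<equiv> lam (Suc m)"
  shows "left_slope (Suc m) (2*n) = (6 - l) / ((2 - l) * (5 - l)) * left_slope m n"
    "right_slope (Suc m) (Suc (2*n)) = (6 - l) / ((2 - l) * (5 - l)) * right_slope m n"
    "right_slope (Suc m) (2*n) = (6 - l) / (2 * (5 - l)) * (val m (Suc n) - val m n)"
    "left_slope (Suc m) (Suc (2*n)) = (6 - l) / (2 * (5 - l)) * (val m (Suc n) - val m n)"
proof -
  note l = lam_step(7,8)[OF m, folded l_def]
  note lm = lam_step(1)[OF m, folded l_def]
  note d = decimation_algebra[OF l, folded lm]
  note e = refine_values[OF m n, folded l_def]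
  have e3: "val (Suc m) (Suc (2*n)) =
      ((4 - l) * (val m (Suc n) + val m n) + 2 * opp m n) / ((2 - l) * (5 - l))"
    unfolding e(3) by (simp add: add.commute)
  show "left_slope (Suc m) (2*n) = (6 - l) / ((2 - l) * (5 - l)) * left_slope m n"
    unfolding left_slope_def l_def[symmetric] e(1,3,4) by (rule d(1))
  show "left_slope (Suc m) (Suc (2*n)) = (6 - l) / (2 * (5 - l)) * (val m (Suc n) - val m n)"
    unfolding left_slope_def l_def[symmetric] e(2,5) e3 by (rule d(2))
  have "right_slope (Suc m) (2*n) =
      - (val m n + opp (Suc m) (2*n) - (2 - l/2) * val (Suc m) (Suc (2*n)))"
    unfolding right_slope_def l_def[symmetric] e(1) by simp
  also have "\<dots> = - ((6 - l) / (2 * (5 - l)) * (val m n - val m (Suc n)))"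
    unfolding e(3,4) by (simp only: d(2))
  finally show "right_slope (Suc m) (2*n) = (6 - l) / (2 * (5 - l)) * (val m (Suc n) - val m n)"
    by (simp only: mult_minus_right[symmetric] minus_diff_eq)
  have "right_slope (Suc m) (Suc (2*n)) =
      - (val (Suc m) (Suc (2*n)) + opp (Suc m) (Suc (2*n)) - (2 - l/2) * val m (Suc n))"
    unfolding right_slope_def l_def[symmetric] e(2) by simp
  also have "\<dots> = - ((6 - l) / ((2 - l) * (5 - l)) * (val m n + opp m n - (2 - lam m / 2) * val m (Suc n)))"
    unfolding e3 e(5) by (simp only: d(1))
  also have "\<dots> = (6 - l) / ((2 - l) * (5 - l)) * - (val m n + opp m n - (2 - lam m / 2) * val m (Suc n))"
    by (simp only: mult_minus_right)
  also have "- (val m n + opp m n - (2 - lam m / 2) * val m (Suc n)) = right_slope m n"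
    unfolding right_slope_def by simp
  finally show "right_slope (Suc m) (Suc (2*n)) = (6 - l) / ((2 - l) * (5 - l)) * right_slope m n" .
qed

text \<open>
  This is the graph eigenvalue equation at the interior vertices of the edge: the values at the four
  neighbours of a vertex add up to \<open>4 - \<lambda>\<close> times its own value.
\<close>

definition matched :: "nat \<Rightarrow> bool" where
  "matched m \<longleftrightarrow> (\<forall>n. Suc n < 2^m \<longrightarrow> right_slope m n = left_slope m (Suc n))"

text \<open>
  At an old vertex both one-sided slopes are multiplied by the same factor.  At a new vertex both are the
  same multiple of the increment over the cell.
\<close>

lemma matched_refine:
  assumes "matched m0" "m0 \<le> m"
  shows "matched m"
  using assms(2)
proof (induction m rule: dec_induct)
  case base
  show ?case by (rule assms)
next
  case (step m)
  note m = step.hyps(1)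
  show ?case unfolding matched_def
  proof (intro allI impI)
    fix n :: nat assume n: "Suc n < 2^Suc m"
    obtain l where l: "n = 2*l \<or> n = Suc (2*l)" by (metis oddE evenE Suc_eq_plus1)
    from l show "right_slope (Suc m) n = left_slope (Suc m) (Suc n)"
    proof
      assume "n = 2*l"
      then show ?thesis using refine_slopes[OF m, of l] n by simp
    next
      assume nl: "n = Suc (2*l)"
      then have "Suc n = 2 * Suc l" "Suc l < 2^m" using n by auto
      then show ?thesis
        using refine_slopes(2)[OF m, of l] refine_slopes(1)[OF m, of "Suc l"] step.IH nl
        by (simp add: matched_def)
    qed
  qed
qed

definition slope :: "nat \<Rightarrow> nat \<Rightarrow> real" where
  "slope m n = (if n < 2^m then left_slope m n else right_slope m (n - 1))"

lemma slope_ends: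
  assumes "matched m" "n < 2^m"
  shows "slope m n = left_slope m n" "slope m (Suc n) = right_slope m n"
  using assms by (auto simp: slope_def matched_def)

lemma slope_old:
  assumes m: "m0 \<le> m" and mm: "matched m0" and n: "n \<le> 2^m"
  shows "slope (Suc m) (2*n) = (6 - lam (Suc m)) / ((2 - lam (Suc m)) * (5 - lam (Suc m))) * slope m n"
proof (cases "n < 2^m")
  case True
  then show ?thesis using refine_slopes(1)[OF m True] by (simp add: slope_def)
next
  case False
  then obtain l where l: "n = Suc l" "l < 2^m" using n by (cases n) auto
  have "2 * n = Suc (Suc (2*l))" "Suc (2*l) < 2^Suc m" using l by auto
  then show ?thesis
    using slope_ends(2)[OF matched_refine[OF mm, of "Suc m"], of "Suc (2*l)"] m
      slope_ends(2)[OF matched_refine[OF mm m] l(2)] refine_slopes(2)[OF m l(2)] l by simp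
qed

lemma slope_new:
  assumes "m0 \<le> m" "n < 2^m"
  shows "slope (Suc m) (Suc (2*n)) = (6 - lam (Suc m)) / (2 * (5 - lam (Suc m))) * (val m (Suc n) - val m n)"
  using refine_slopes(4)[OF assms] assms by (simp add: slope_def)

text \<open>
  The value at the vertex off the edge cancels in the sum of the slopes at the two ends of a cell.  This is
  why the slopes determine the increments.
\<close>

lemma slope_sum:
  assumes "m0 \<le> m" "matched m0" "n < 2^m"
  shows "slope m n + slope m (Suc n) = (6 - lam m) / 2 * (val m (Suc n) - val m n)"
  by (simp add: slope_ends[OF matched_refine[OF assms(2,1)] assms(3)] left_slope_def right_slope_def field_simps)

lemma lam_less_6:
  assumes "m0 \<le> m1" "lam m1 < 6" "m1 \<le> m"
  shows "lam m < 6"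
proof (cases "m = m1")
  case False
  then obtain l where "m = Suc l" "m1 \<le> l" using assms(3) by (cases m) auto
  then show ?thesis using lam_step(3)[of l] assms(1) by simp
qed (use assms in simp)

theorem slope_refinementI:
  assumes mm: "matched m0" and m1: "m0 \<le> m1" "lam m1 < 6"
    and start_nonzero: "\<And>n. n < 2^m1 \<Longrightarrow> slope m1 n \<noteq> 0 \<or> slope m1 (Suc n) \<noteq> 0"
    and start_flank: "\<And>n. Suc n < 2^m1 \<Longrightarrow> slope m1 (Suc n) = 0 \<Longrightarrow> slope m1 n * slope m1 (Suc (Suc n)) < 0"
  shows "slope_refinement (\<lambda>t. u (edge_point q i j t)) slope (\<lambda>m. 2 / (6 - lam m))
    (\<lambda>m. (6 - lam (Suc m)) / ((2 - lam (Suc m)) * (5 - lam (Suc m))))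
    (\<lambda>m. (6 - lam (Suc m)) / ((5 - lam (Suc m)) * (6 - lam m))) \<epsilon> m1"
proof
  have "edge_point q i j ` {0..1} \<subseteq> SG q"
    using edge_subset_SG[of q i j] closed_segment_image_interval[of "q i" "q j"]
    by (simp add: edge_point_def[abs_def])
  then show "continuous_on {0..1} (\<lambda>t. u (edge_point q i j t))"
    by (intro continuous_on_compose2[OF cont_u]) (auto simp: edge_point_def[abs_def] intro!: continuous_intros)
next
  fix m n assume m: "m1 \<le> m"
  then have m0: "m0 \<le> m" using m1 by simp
  note less6 = lam_less_6[OF m1 m]
  note st = lam_step[OF m0]
  show "2 / (6 - lam m) > 0" using less6 by simp
  show "(6 - lam (Suc m)) / ((5 - lam (Suc m)) * (6 - lam m)) > 0" using less6 st by simp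
  show "\<epsilon> (Suc m) \<in> {1, -1}" using signs[OF m0] by auto
  show "n \<le> 2^m \<Longrightarrow> slope (Suc m) (2*n) =
      (6 - lam (Suc m)) / ((2 - lam (Suc m)) * (5 - lam (Suc m))) * slope m n"
    by (rule slope_old[OF m0 mm])
  show "slope (Suc m) (2*n + 1) = (6 - lam (Suc m)) / ((5 - lam (Suc m)) * (6 - lam m)) * (slope m n + slope m (Suc n))"
    if "n < 2^m"
    unfolding Suc_eq_plus1[symmetric] slope_new[OF m0 that] slope_sum[OF m0 mm that]
    using less6 by simp
  show "u (edge_point q i j (real (Suc n) / 2^m)) - u (edge_point q i j (real n / 2^m)) =
      2 / (6 - lam m) * (slope m n + slope m (Suc n))" if "n < 2^m"
    unfolding slope_sum[OF m0 mm that] using less6 by (simp add: val_def)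
  have f: "6 - lam m = (2 - lam (Suc m)) * (3 - lam (Suc m))" using st(1) by (simp add: algebra_simps)
  show "(6 - lam (Suc m)) / ((5 - lam (Suc m)) * (6 - lam m)) \<le>
      (6 - lam (Suc m)) / ((2 - lam (Suc m)) * (5 - lam (Suc m)))" if "\<epsilon> (Suc m) = -1"
  proof -
    have l2: "lam (Suc m) < 2" using st(4) that .
    then have "(2 - lam (Suc m)) * 1 \<le> 6 - lam m" unfolding f by (intro mult_left_mono) auto
    then have "(2 - lam (Suc m)) * (5 - lam (Suc m)) \<le> (5 - lam (Suc m)) * (6 - lam m)"
      using l2 by (simp add: mult.commute)
    then show ?thesis using l2 less6 by (intro divide_left_mono) auto
  qed
  show "(6 - lam (Suc m)) / ((2 - lam (Suc m)) * (5 - lam (Suc m))) < 0" if "\<epsilon> (Suc m) = 1"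
    using st(3) st(5)[OF that] by (intro divide_pos_neg mult_neg_pos) auto
qed (use start_nonzero start_flank in auto)

end

section \<open>The graph Laplacian at the midpoint of an edge\<close>

text \<open>
  The coordinate that separates \<open>q i\<close> from the opposite edge: the inner product with the altitude
  through \<open>q i\<close>, which is orthogonal to that edge since the triangle is equilateral.
\<close>

lemma barycentric_coordinate:
  assumes q: "equilateral_triangle q"
  shows "\<exists>c :: real^2 \<Rightarrow> real. (\<forall>a x. c (F q a x) = (c x + c (q a)) / 2) \<and>
    (\<forall>a. c (q a) = of_bool (a = i))"
proof -
  obtain j k where ijk: "distinct [i, j, k]"
  proof
    show "distinct [i, i + 1, i + 2]" by simp
  qed
  obtain s where s: "s > 0" "\<And>a b. a \<noteq> b \<Longrightarrow> dist (q a) (q b) = s"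
    using q by (auto simp: equilateral_triangle_def)
  define n where "n = q i - midpoint (q j) (q k)"
  define c where "c = (\<lambda>x. ((x - q j) \<bullet> n) / (n \<bullet> n))"
  have sq: "(q a - q b) \<bullet> (q a - q b) = s\<^sup>2" if "a \<noteq> b" for a b
    using s(2)[OF that] by (simp add: dist_norm dot_square_norm)
  have n2: "n = (1/2) *\<^sub>R (q i - q j) + (1/2) *\<^sub>R (q i - q k)"
    by (vector n_def midpoint_def) (simp add: field_simps)
  have kj: "(q k - q j) \<bullet> n = 0"
  proof -
    have "q k - q j = (q i - q j) - (q i - q k)" by simp
    then have "(q k - q j) \<bullet> n = ((q i - q j) \<bullet> (q i - q j) - (q i - q k) \<bullet> (q i - q k)) / 2"
      unfolding n2 by (simp only: inner_simps) (simp add: inner_commute field_simps)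
    then show ?thesis using sq[of i j] sq[of i k] ijk by simp
  qed
  have ij: "(q i - q j) \<bullet> n = n \<bullet> n"
  proof -
    have "q i - q j = n + (1/2) *\<^sub>R (q k - q j)"
      by (vector n_def midpoint_def) (simp add: field_simps)
    then have "(q i - q j) \<bullet> n = n \<bullet> n + (1/2) * ((q k - q j) \<bullet> n)"
      by (simp only: inner_add_left inner_scaleR_left)
    then show ?thesis using kj by simp
  qed
  have n0: "n \<bullet> n \<noteq> 0"
  proof
    assume "n \<bullet> n = 0"
    then have "q i = midpoint (q j) (q k)" by (simp add: n_def)
    moreover have "midpoint (q j) (q k) - q j = (1/2) *\<^sub>R (q k - q j)"
      by (vector midpoint_def)
    ultimately have "q i - q j = (1/2) *\<^sub>R (q k - q j)" by simp
    then have "norm (q i - q j) = norm (q k - q j) / 2" by simp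
    moreover have "norm (q i - q j) = s" "norm (q k - q j) = s"
      using s(2)[of i j] s(2)[of k j] ijk by (auto simp: dist_norm)
    ultimately show False using s(1) by simp
  qed
  show ?thesis
  proof (intro exI[of _ c] conjI allI)
    fix a x
    have "F q a x - q j = (1/2) *\<^sub>R ((x - q j) + (q a - q j))"
      by (vector F_def) (simp add: field_simps)
    then show "c (F q a x) = (c x + c (q a)) / 2"
      by (simp only: c_def inner_add_left inner_scaleR_left) (simp add: add_divide_distrib)
  next
    fix a
    show "c (q a) = of_bool (a = i)"
    proof -
      have "a \<in> {i, j, k}" using UNIV_triple[OF ijk] by auto
      then show ?thesis using ijk kj ij n0 by (auto simp: c_def)
    qed
  qed
qed

lemma inj_F: "inj (F q a)"
  by (rule injI) (metis F_dist dist_eq_0_iff divide_eq_0_iff zero_neq_numeral)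

lemma inj_Fw: "inj (Fw q w)"
proof (induction w)
  case (Cons a w)
  then have "inj (F q a \<circ> Fw q w)" by (intro inj_compose inj_F)
  then show ?case by (simp add: comp_def)
qed (simp add: inj_def)

lemma inj_triangle: "equilateral_triangle q \<Longrightarrow> inj q"
  by (rule injI) (metis dist_self equilateral_triangle_def less_irrefl)

lemma Fw_corner:
  assumes q: "equilateral_triangle q"
  shows "Fw q w (q l) = q i \<Longrightarrow> w = replicate (length w) i \<and> l = i"
proof -
  obtain c :: "real^2 \<Rightarrow> real" where c: "\<And>a x. c (F q a x) = (c x + c (q a)) / 2" "\<And>a. c (q a) = of_bool (a = i)"
    using barycentric_coordinate[OF q, of i] by blast
  have "c (Fw q w (q l)) \<le> 1 \<and> (c (Fw q w (q l)) = 1 \<longrightarrow> (\<forall>a\<in>set w. a = i) \<and> l = i)"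
  proof (induction w)
    case (Cons a w)
    then show ?case by (cases "a = i") (auto simp: c)
  qed (auto simp: c)
  moreover assume "Fw q w (q l) = q i"
  then have "c (Fw q w (q l)) = 1" by (simp add: c(2))
  ultimately have "\<forall>a\<in>set w. a = i" "l = i" by blast+
  then show "w = replicate (length w) i \<and> l = i"
    using replicate_length_same[of w i] by (intro conjI) (rule sym, simp)
qed

lemma Fw_replicate_corner: "Fw q (replicate n a) (q a) = q a"
  by (induction n) (simp_all add: F_vertex)

text \<open>
  The midpoint of an edge is a vertex of exactly two cells of each level \<open>Suc n\<close>.  In a cell with another
  first letter the coordinate that belongs to this letter is positive, but it vanishes at the midpoint.
\<close>

lemma Fw_edge_midpoint:
  assumes q: "equilateral_triangle q" and ij: "i \<noteq> j" and w: "length w = Suc n"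
  shows "Fw q w (q l) = midpoint (q i) (q j) \<longleftrightarrow>
    (w = i # replicate n j \<and> l = j) \<or> (w = j # replicate n i \<and> l = i)" (is "?L \<longleftrightarrow> ?R")
proof
  assume ?R
  then show ?L by (auto simp: Fw_replicate_corner F_vertex midpoint_sym)
next
  assume L: ?L
  obtain a v where v: "w = a # v" "length v = n" using w by (cases w) auto
  have half: "v = replicate n b \<and> l = b" if "midpoint (q i) (q j) = midpoint (q a) (q b)" for b
  proof -
    have "F q a (Fw q v (q l)) = F q a (q b)" using L v that by (simp add: F_vertex)
    then have "Fw q v (q l) = q b" using inj_F by (metis injD)
    then show ?thesis using Fw_corner[OF q] v(2) by blast
  qed
  show ?R
  proof (cases "a = i \<or> a = j")
    case True
    then show ?thesis using half[of i] half[of j] v(1) by (auto simp: midpoint_sym)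
  next
    case False
    obtain c :: "real^2 \<Rightarrow> real" where c: "\<And>b x. c (F q b x) = (c x + c (q b)) / 2" "\<And>b. c (q b) = of_bool (b = a)"
      using barycentric_coordinate[OF q, of a] by blast
    have "c (Fw q v (q l)) \<ge> 0" by (induction v) (auto simp: c)
    then have "c (Fw q w (q l)) > 0" by (simp add: v c)
    moreover have "c (midpoint (q i) (q j)) = 0"
      using False by (auto simp: c simp flip: F_vertex)
    ultimately show ?thesis using L by simp
  qed
qed

text \<open>
  The coordinate of \<open>q j\<close> is at least \<open>1/2\<close> on the cells that start with \<open>j\<close>, and less than \<open>1/2\<close> at the
  two other vertices of the cell at \<open>v\<close>.  So the four neighbours are distinct.
\<close>

lemma edge_midpoint_neighbours:
  fixes n :: nat
  assumes q: "equilateral_triangle q" and ijk: "distinct [i, j, k]"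
  defines "v \<equiv> i # replicate n j" and "w \<equiv> j # replicate n i"
  shows "{y. adj q (Suc n) (midpoint (q i) (q j)) y} =
      {Fw q v (q i), Fw q v (q k), Fw q w (q j), Fw q w (q k)}"
    and "distinct [Fw q v (q i), Fw q v (q k), Fw q w (q j), Fw q w (q k)]"
proof -
  let ?x = "midpoint (q i) (q j)"
  have ij: "i \<noteq> j" using ijk by simp
  have len: "length v = Suc n" "length w = Suc n" by (simp_all add: v_def w_def)
  note mid = Fw_edge_midpoint[OF q ij]
  have x: "Fw q v (q l) = ?x \<longleftrightarrow> l = j" "Fw q w (q l) = ?x \<longleftrightarrow> l = i" for l
    unfolding mid[OF len(1)] mid[OF len(2)] by (auto simp: v_def w_def ij)
  have inj: "Fw q w' (q a) = Fw q w' (q b) \<longleftrightarrow> a = b" for w' a b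
    using inj_Fw inj_triangle[OF q] by (metis injD)
  have cell: "?x \<in> Fw q w' ` V q 0 \<longleftrightarrow> w' = v \<or> w' = w" if "length w' = Suc n" for w'
    using mid[OF that] by (auto simp: v_def w_def image_iff) metis+
  have U: "range q = {q i, q j, q k}" using UNIV_triple[OF ijk] by auto
  show "{y. adj q (Suc n) ?x y} = {Fw q v (q i), Fw q v (q k), Fw q w (q j), Fw q w (q k)}"
  proof -
    have "adj q (Suc n) ?x y \<longleftrightarrow> ?x \<noteq> y \<and> (y \<in> Fw q v ` range q \<or> y \<in> Fw q w ` range q)" for y
      unfolding adj_def using cell len by (auto simp: image_image)
    moreover have "Fw q v ` range q = {Fw q v (q i), ?x, Fw q v (q k)}"
      "Fw q w ` range q = {?x, Fw q w (q j), Fw q w (q k)}"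
      using x(1)[of j] x(2)[of i] unfolding U by auto
    moreover have "?x \<notin> {Fw q v (q i), Fw q v (q k), Fw q w (q j), Fw q w (q k)}"
      using x ijk by (auto simp: eq_commute[of ?x])
    ultimately show ?thesis by auto
  qed
  have cross: "Fw q v (q a) \<noteq> Fw q w (q b)" if "a \<noteq> j" for a b
  proof
    assume eq: "Fw q v (q a) = Fw q w (q b)"
    obtain c :: "real^2 \<Rightarrow> real" where c: "\<And>b x. c (F q b x) = (c x + c (q b)) / 2" "\<And>b. c (q b) = of_bool (b = j)"
      using barycentric_coordinate[OF q, of j] by blast
    have nn: "0 \<le> c (Fw q w' (q b))" for w' by (induction w') (auto simp: c)
    have le1: "c (Fw q w' (q a)) \<le> 1 \<and> (c (Fw q w' (q a)) = 1 \<longrightarrow> a = j)" for w'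
      by (induction w') (auto simp: c)
    have "c (Fw q v (q a)) < 1/2" using le1[of "replicate n j"] ij that by (auto simp: v_def c)
    moreover have "c (Fw q w (q b)) \<ge> 1/2" using nn[of "replicate n i"] by (simp add: w_def c)
    ultimately show False using eq by simp
  qed
  show "distinct [Fw q v (q i), Fw q v (q k), Fw q w (q j), Fw q w (q k)]"
    using cross ijk by (auto simp: inj)
qed

lemma edge_word_middle: "edge_word i j (Suc m) (2^m) = j # replicate m i"
  by (induction m) (simp_all add: replicate_append_same)

lemma edge_word_before_middle: "edge_word i j (Suc m) (2^m - 1) = i # replicate m j"
proof (induction m)
  case (Suc m)
  have "(2::nat)^Suc m - 1 = Suc (2 * (2^m - 1))" by (induction m) auto
  then have "edge_word i j (Suc (Suc m)) (2^Suc m - 1) = edge_word i j (Suc m) (2^m - 1) @ [j]"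
    by (simp only: edge_word.simps(2)[of _ _ "Suc m"]) simp
  then show ?case using Suc by (simp add: replicate_append_same)
qed simp

context edge_decimation
begin

lemma graph_laplacian_midpoint:
  assumes q: "equilateral_triangle q" and "matched (Suc m)"
  shows "graph_laplacian q (Suc m) u (midpoint (q i) (q j)) =
    - lam (Suc m) * u (midpoint (q i) (q j))"
proof -
  let ?x = "midpoint (q i) (q j)"
  let ?v = "i # replicate m j" and ?w = "j # replicate m i"
  have lt: "2^m - 1 < (2::nat)^Suc m" "(2::nat)^m < 2^Suc m" by (simp_all add: less_imp_diff_less)
  note v = Fw_edge_word_vertices[OF lt(1), of q i j, unfolded edge_word_before_middle]
  note w = Fw_edge_word_vertices[OF lt(2), of q i j, unfolded edge_word_middle]
  have S: "Suc (2^m - 1) = 2^m" by simp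
  have vx: "Fw q ?v (q j) = ?x" by (simp add: Fw_replicate_corner F_vertex)
  have x: "val (Suc m) (2^m) = u ?x"
    using v(2) vx unfolding val_def S by metis
  have "graph_laplacian q (Suc m) u ?x =
      (u (Fw q ?v (q i)) - u ?x) + (u (Fw q ?v (q k)) - u ?x) +
      (u (Fw q ?w (q j)) - u ?x) + (u (Fw q ?w (q k)) - u ?x)"
    unfolding graph_laplacian_def edge_midpoint_neighbours(1)[OF q ijk]
    using edge_midpoint_neighbours(2)[OF q ijk, of m] by simp
  also have "\<dots> = val (Suc m) (2^m - 1) + opp (Suc m) (2^m - 1) + val (Suc m) (Suc (2^m)) + opp (Suc m) (2^m)
      - 4 * val (Suc m) (2^m)"
    unfolding x unfolding val_def opp_def edge_word_middle edge_word_before_middle v(1)[symmetric] w(2)[symmetric]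
    by simp
  also have "\<dots> = - lam (Suc m) * val (Suc m) (2^m)"
  proof -
    have "right_slope (Suc m) (2^m - 1) = left_slope (Suc m) (2^m)"
      using assms(2) lt S unfolding matched_def by metis
    then show ?thesis unfolding right_slope_def left_slope_def S by (simp add: algebra_simps)
  qed
  finally show ?thesis unfolding x .
qed

text \<open>
  A single vertex with a nonzero value identifies the eigenvalue.  The midpoint of the edge serves here,
  since it belongs to every level from the first on.
\<close>

lemma eigenvalue_limit:
  assumes q: "equilateral_triangle q" and mm: "matched m0" and m0: "0 < m0"
    and nz: "u (midpoint (q i) (q j)) \<noteq> 0" and eig: "dirichlet_eigenfunction q u \<Lambda>"
  shows "(\<lambda>n. 3/2 * 5^n * lam n) \<longlonglongrightarrow> \<Lambda>"
proof -
  let ?x = "midpoint (q i) (q j)"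
  have ij: "i \<noteq> j" using ijk by simp
  have V: "Fw q w (q a) \<in> V q (length w)" for w a by (induction w) auto
  have xV: "?x \<in> V q (Suc m)" for m
    using V[of "i # replicate m j" j] by (simp add: Fw_replicate_corner F_vertex)
  have x0: "?x \<notin> V q 0"
  proof
    assume "?x \<in> V q 0"
    then obtain a where a: "q a = F q i (q j)" by (auto simp: F_vertex)
    show False using Fw_corner[OF q, of "[i]" j a] a ij by auto
  qed
  have "(\<lambda>n. - (3/2 * 5^n * lam n * u ?x)) \<longlonglongrightarrow> - \<Lambda> * u ?x"
  proof (rule LIMSEQ_I)
    fix e :: real assume "e > 0"
    then obtain N where N: "\<And>m x. m \<ge> N \<Longrightarrow> x \<in> V q m - V q 0 \<Longrightarrow>
        \<bar>3/2 * 5^m * graph_laplacian q m u x - - \<Lambda> * u x\<bar> < e"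
      using eig unfolding dirichlet_eigenfunction_def has_laplacian_def by blast
    have "norm (- (3/2 * 5^m * lam m * u ?x) - - \<Lambda> * u ?x) < e" if m: "m \<ge> max N m0" for m
    proof -
      obtain l where l: "m = Suc l" using m m0 by (cases m) auto
      have "matched m" using matched_refine[OF mm] m by simp
      then have "graph_laplacian q m u ?x = - lam m * u ?x"
        unfolding l by (rule graph_laplacian_midpoint[OF q])
      moreover have "?x \<in> V q m - V q 0" using xV x0 l by blast
      ultimately show ?thesis using N[of m ?x] m by simp
    qed
    then show "\<exists>no. \<forall>n\<ge>no. norm (- (3/2 * 5^n * lam n * u ?x) - - \<Lambda> * u ?x) < e" by blast
  qed
  then have "(\<lambda>n. - (3/2 * 5^n * lam n * u ?x) * - (1 / u ?x)) \<longlonglongrightarrow> - \<Lambda> * u ?x * - (1 / u ?x)"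
    by (intro tendsto_mult tendsto_const)
  then show ?thesis using nz by simp
qed

end

section \<open>The order of the eigenvalues\<close>

text \<open>
  Decoding of a binary reflected Gray code: a sign \<open>1\<close> that follows \<open>K\<close> others reflects the numbers below \<open>2^K\<close>
  into the upper half of the numbers below \<open>2^(K+1)\<close>.
\<close>

primrec rank_upto :: "nat \<Rightarrow> (nat \<Rightarrow> real) \<Rightarrow> nat \<Rightarrow> nat" where
  "rank_upto m \<epsilon> 0 = 0"
| "rank_upto m \<epsilon> (Suc K) =
     (if \<epsilon> (m + Suc K) = -1 then rank_upto m \<epsilon> K else 2^Suc K - 1 - rank_upto m \<epsilon> K)"

definition sign_rank :: "nat \<Rightarrow> (nat \<Rightarrow> real) \<Rightarrow> nat" where
  "sign_rank m \<epsilon> = rank_upto m \<epsilon> (LEAST K. \<forall>m'>m+K. \<epsilon> m' = -1)"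

lemma rank_upto_less: "rank_upto m \<epsilon> K < 2^K"
  by (induction K) auto

lemma sign_rank_eq:
  assumes tail: "\<forall>m'>m+K. \<epsilon> m' = -1"
  shows "sign_rank m \<epsilon> = rank_upto m \<epsilon> K"
proof -
  define L where "L = (LEAST K. \<forall>m'>m+K. \<epsilon> m' = -1)"
  have L: "\<forall>m'>m+L. \<epsilon> m' = -1" unfolding L_def by (rule LeastI[of _ K]) (rule tail)
  have "L \<le> K" unfolding L_def by (rule Least_le) (rule tail)
  then have "rank_upto m \<epsilon> K = rank_upto m \<epsilon> L"
    by (induction K rule: dec_induct) (use L in auto)
  then show ?thesis by (simp add: sign_rank_def L_def)
qed

lemma admissible_signs_tail:
  assumes "\<epsilon> \<in> admissible_signs m"
  obtains K where "\<forall>m'>m+K. \<epsilon> m' = -1"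
proof -
  have "finite {m'. m' > m \<and> \<epsilon> m' \<noteq> -1}" using assms by (simp add: admissible_signs_def)
  then obtain K where K: "\<forall>m'\<in>{m'. m' > m \<and> \<epsilon> m' \<noteq> -1}. m' < K"
    using finite_nat_set_iff_bounded by blast
  have "\<epsilon> m' = -1" if "m' > m + K" for m'
  proof (rule ccontr)
    assume "\<epsilon> m' \<noteq> -1"
    then have "m' < K" using K that by simp
    then show False using that by simp
  qed
  then show ?thesis using that by blast
qed

lemma ex_sign_rank: "\<exists>\<epsilon>\<in>admissible_signs m. sign_rank m \<epsilon> = n"
proof -
  have "\<exists>\<epsilon>. (\<forall>m'. \<epsilon> m' \<in> {1, -1}) \<and> (\<forall>m'>m+K. \<epsilon> m' = -1) \<and> rank_upto m \<epsilon> K = n" if "n < 2^K" for K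
    using that
  proof (induction K arbitrary: n)
    case 0
    then show ?case by (intro exI[of _ "\<lambda>_. -1"]) auto
  next
    case (Suc K)
    show ?case
    proof (cases "n < 2^K")
      case True
      from Suc.IH[OF this] obtain \<epsilon> where \<epsilon>: "\<forall>m'. \<epsilon> m' \<in> {1, -1}" "\<forall>m'>m+K. \<epsilon> m' = -1" "rank_upto m \<epsilon> K = n"
        by blast
      then show ?thesis by (intro exI[of _ \<epsilon>]) auto
    next
      case False
      then have "2^Suc K - 1 - n < 2^K" using Suc.prems by auto
      from Suc.IH[OF this] obtain \<epsilon> where \<epsilon>: "\<forall>m'. \<epsilon> m' \<in> {1, -1}" "\<forall>m'>m+K. \<epsilon> m' = -1"
        "rank_upto m \<epsilon> K = 2^Suc K - 1 - n" by blast
      define \<delta> where "\<delta> = \<epsilon>(m + Suc K := 1)"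
      have same: "rank_upto m \<delta> L = rank_upto m \<epsilon> L" if "L \<le> K" for L
        using that by (induction L) (auto simp: \<delta>_def)
      have "\<delta> (m + Suc K) = 1" by (simp add: \<delta>_def)
      then have "rank_upto m \<delta> (Suc K) = n"
        using same[of K] \<epsilon>(3) Suc.prems by simp
      moreover have "\<forall>m'. \<delta> m' \<in> {1, -1}" "\<forall>m'>m + Suc K. \<delta> m' = -1"
        using \<epsilon>(1,2) by (auto simp: \<delta>_def)
      ultimately show ?thesis by blast
    qed
  qed
  from this[OF less_exp] obtain \<epsilon> where \<epsilon>: "\<forall>m'. \<epsilon> m' \<in> {1, -1}" "\<forall>m'>m+n. \<epsilon> m' = -1" "rank_upto m \<epsilon> n = n"
    by blast
  have "{m'. m' > m \<and> \<epsilon> m' \<noteq> -1} \<subseteq> {..m+n}" using \<epsilon>(2) by (auto simp flip: not_less)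
  then have "\<epsilon> \<in> admissible_signs m" using \<epsilon>(1) finite_subset by (auto simp: admissible_signs_def)
  then show ?thesis using sign_rank_eq[OF \<epsilon>(2)] \<epsilon>(3) by auto
qed

lemma sign_rank_cong:
  assumes "\<And>m'. m < m' \<Longrightarrow> \<epsilon> m' = \<delta> m'"
  shows "sign_rank m \<epsilon> = sign_rank m \<delta>"
proof -
  have "rank_upto m \<epsilon> K = rank_upto m \<delta> K" for K by (induction K) (auto simp: assms)
  moreover have "(\<forall>m'>m+K. \<epsilon> m' = -1) \<longleftrightarrow> (\<forall>m'>m+K. \<delta> m' = -1)" for K by (auto simp: assms)
  ultimately show ?thesis by (simp add: sign_rank_def)
qed

lemma decimation_value_range:
  assumes "0 < l0" "l0 < 6" "\<forall>m'>m. \<epsilon> m' \<in> {1, -1}"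
  shows "0 < decimation_value m l0 \<epsilon> K \<and> decimation_value m l0 \<epsilon> K < 6"
proof (induction K)
  case (Suc K)
  have "\<epsilon> (m + Suc K) = 1 \<or> \<epsilon> (m + Suc K) = -1" using assms(3) by simp
  then show ?case
    using decimation_step(2,3)[of "decimation_value m l0 \<epsilon> K" "\<epsilon> (m + Suc K)"] Suc by auto
qed (use assms in simp)

text \<open>
  If the last signs agree, the increasing branch keeps the order of the values and the decreasing branch
  reverses it, as the ranks do.  If they differ, the branch with sign \<open>1\<close> has values above \<open>5/2\<close> and the
  other one below, and the ranks lie in the upper and the lower half.
\<close>

lemma decimation_value_order:
  assumes l0: "0 < l0" "l0 < 6"
    and \<epsilon>: "\<forall>m'>m. \<epsilon> m' \<in> {1, -1}" and \<delta>: "\<forall>m'>m. \<delta> m' \<in> {1, -1}"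
  shows "(rank_upto m \<epsilon> K = rank_upto m \<delta> K \<longrightarrow> decimation_value m l0 \<epsilon> K = decimation_value m l0 \<delta> K) \<and>
    (rank_upto m \<epsilon> K < rank_upto m \<delta> K \<longrightarrow> decimation_value m l0 \<epsilon> K < decimation_value m l0 \<delta> K) \<and>
    (rank_upto m \<delta> K < rank_upto m \<epsilon> K \<longrightarrow> decimation_value m l0 \<delta> K < decimation_value m l0 \<epsilon> K)"
proof (induction K)
  case (Suc K)
  let ?x = "decimation_value m l0 \<epsilon> K" and ?y = "decimation_value m l0 \<delta> K"
  have r: "1 < sqrt (25 - 4 * ?x)" "1 < sqrt (25 - 4 * ?y)"
    using decimation_value_range[OF l0 \<epsilon>, of K] decimation_value_range[OF l0 \<delta>, of K]
    by (auto intro!: real_less_rsqrt)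
  have mono: "?x < ?y \<longleftrightarrow> sqrt (25 - 4 * ?y) < sqrt (25 - 4 * ?x)"
    "?y < ?x \<longleftrightarrow> sqrt (25 - 4 * ?x) < sqrt (25 - 4 * ?y)"
    "?x = ?y \<longleftrightarrow> sqrt (25 - 4 * ?x) = sqrt (25 - 4 * ?y)" by auto
  have lt: "rank_upto m \<epsilon> K < 2^K" "rank_upto m \<delta> K < 2^K" by (rule rank_upto_less)+
  have e: "\<epsilon> (m + Suc K) = 1 \<or> \<epsilon> (m + Suc K) = -1" "\<delta> (m + Suc K) = 1 \<or> \<delta> (m + Suc K) = -1"
    using \<epsilon> \<delta> by auto
  define a b where "a = sqrt (25 - 4 * ?x)" and "b = sqrt (25 - 4 * ?y)"
  define i j where "i = rank_upto m \<epsilon> K" and "j = rank_upto m \<delta> K"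
  define P where "P = (2::nat)^K"
  have IH: "(i = j \<longrightarrow> a = b) \<and> (i < j \<longrightarrow> b < a) \<and> (j < i \<longrightarrow> a < b)"
    using Suc unfolding mono a_def b_def i_def j_def by blast
  have ij: "i < P" "j < P" and ab: "1 < a" "1 < b"
    using lt r by (simp_all add: i_def j_def P_def a_def b_def)
  have p: "(2::nat)^Suc K = 2 * P" by (simp add: P_def)
  show ?case
    unfolding rank_upto.simps decimation_value.simps i_def[symmetric] j_def[symmetric]
      a_def[symmetric] b_def[symmetric] p
    using e by (elim disjE) (use IH ij ab in \<open>auto split: if_splits\<close>)
qed simp

text \<open>
  The branch with sign \<open>-1\<close> has derivative at least \<open>1/5\<close>, so multiplication by \<open>5\<close> does not let
  differences shrink.  Strict inequalities therefore survive the limit that defines the eigenvalue.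
\<close>

lemma minus_branch_expands:
  assumes "0 \<le> x" "x \<le> y" "y < (6::real)"
  shows "y - x \<le> 5 * ((5 - sqrt (25 - 4 * y)) / 2 - (5 - sqrt (25 - 4 * x)) / 2)"
proof -
  define a b where "a = sqrt (25 - 4 * x)" and "b = sqrt (25 - 4 * y)"
  have ab: "0 \<le> b" "b \<le> a" "a \<le> 5" "a * a - b * b = 4 * (y - x)"
    using assms by (auto simp: a_def b_def intro!: real_le_lsqrt)
  have "4 * (y - x) = (a - b) * (a + b)" using ab(4) by (simp add: algebra_simps)
  also have "\<dots> \<le> (a - b) * 10" using ab by (intro mult_left_mono) auto
  finally have "y - x \<le> (a - b) * 10 / 4" by simp
  also have "\<dots> = 5 * ((5 - b) / 2 - (5 - a) / 2)" by (simp add: field_simps)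
  finally show ?thesis unfolding a_def b_def .
qed

lemma eigenvalue_order:
  assumes l0: "0 < l0" "l0 < 6"
    and \<epsilon>: "\<epsilon> \<in> admissible_signs m" and \<delta>: "\<delta> \<in> admissible_signs m"
    and lim: "(\<lambda>k. 3/2 * 5^(m+k) * decimation_value m l0 \<epsilon> k) \<longlonglongrightarrow> \<Lambda>"
      "(\<lambda>k. 3/2 * 5^(m+k) * decimation_value m l0 \<delta> k) \<longlonglongrightarrow> \<Lambda>'"
  shows "sign_rank m \<epsilon> = sign_rank m \<delta> \<Longrightarrow> \<Lambda> = \<Lambda>'" "sign_rank m \<epsilon> < sign_rank m \<delta> \<Longrightarrow> \<Lambda> < \<Lambda>'"
proof -
  let ?x = "decimation_value m l0 \<epsilon>" and ?y = "decimation_value m l0 \<delta>"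
  have s: "\<forall>m'>m. \<epsilon> m' \<in> {1, -1}" "\<forall>m'>m. \<delta> m' \<in> {1, -1}"
    using \<epsilon> \<delta> by (auto simp: admissible_signs_def)
  obtain K1 K2 where K12: "\<forall>m'>m+K1. \<epsilon> m' = -1" "\<forall>m'>m+K2. \<delta> m' = -1"
    using admissible_signs_tail \<epsilon> \<delta> by metis
  define K where "K = max K1 K2"
  have K: "\<forall>m'>m+K. \<epsilon> m' = -1" "\<forall>m'>m+K. \<delta> m' = -1" using K12 by (auto simp: K_def)
  note ord = decimation_value_order[OF l0 s, of K, folded sign_rank_eq[OF K(1)] sign_rank_eq[OF K(2)]]
  have step: "?x (Suc (K+d)) = (5 - sqrt (25 - 4 * ?x (K+d))) / 2"
    "?y (Suc (K+d)) = (5 - sqrt (25 - 4 * ?y (K+d))) / 2" for d using K by simp_all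
  have range: "0 < ?x d \<and> ?x d < 6" "0 < ?y d \<and> ?y d < 6" for d
    by (rule decimation_value_range[OF l0 s(1)] decimation_value_range[OF l0 s(2)])+
  have lim': "(\<lambda>d. 3/2 * 5^(m+(d+K)) * ?x (d+K)) \<longlonglongrightarrow> \<Lambda>" "(\<lambda>d. 3/2 * 5^(m+(d+K)) * ?y (d+K)) \<longlonglongrightarrow> \<Lambda>'"
    by (rule LIMSEQ_ignore_initial_segment[OF lim(1), of K] LIMSEQ_ignore_initial_segment[OF lim(2), of K])+
  show "\<Lambda> = \<Lambda>'" if "sign_rank m \<epsilon> = sign_rank m \<delta>"
  proof -
    have "?x (K+d) = ?y (K+d)" for d
      by (induction d) (use ord that in \<open>simp_all del: decimation_value.simps add: step\<close>)
    then have eq: "?x (d+K) = ?y (d+K)" for d by (simp only: add.commute[of d K])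
    show ?thesis by (rule LIMSEQ_unique[OF lim'(1)[unfolded eq] lim'(2)])
  qed
  show "\<Lambda> < \<Lambda>'" if "sign_rank m \<epsilon> < sign_rank m \<delta>"
  proof -
    have base: "?x K < ?y K" using ord that by blast
    have grow: "?y K - ?x K \<le> 5^d * (?y (K+d) - ?x (K+d)) \<and> ?x (K+d) < ?y (K+d)" for d
    proof (induction d)
      case (Suc d)
      have exp: "?y (K+d) - ?x (K+d) \<le> 5 * (?y (Suc (K+d)) - ?x (Suc (K+d)))"
        using minus_branch_expands[of "?x (K+d)" "?y (K+d)"] range[of "K+d"] Suc
        unfolding step by auto
      then have "5^d * (?y (K+d) - ?x (K+d)) \<le> 5^d * (5 * (?y (Suc (K+d)) - ?x (Suc (K+d))))"
        by (intro mult_left_mono) auto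
      with Suc have "?y K - ?x K \<le> 5^d * (5 * (?y (Suc (K+d)) - ?x (Suc (K+d))))"
        by (meson order_trans)
      then have "?y K - ?x K \<le> 5^Suc d * (?y (K + Suc d) - ?x (K + Suc d))"
        by (simp only: power_Suc2 mult.assoc add_Suc_right)
      moreover have "?x (K + Suc d) < ?y (K + Suc d)" using exp Suc by (simp del: decimation_value.simps)
      ultimately show ?case by blast
    qed (use base in simp)
    have "3/2 * 5^(m+K) * (?y K - ?x K) \<le> 3/2 * 5^(m+(d+K)) * ?y (d+K) - 3/2 * 5^(m+(d+K)) * ?x (d+K)" for d
    proof -
      have "3/2 * 5^(m+K) * (?y K - ?x K) \<le> 3/2 * 5^(m+K) * (5^d * (?y (K+d) - ?x (K+d)))"
        by (intro mult_left_mono grow[THEN conjunct1]) simp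
      also have "\<dots> = 3/2 * 5^(m+(d+K)) * ?y (d+K) - 3/2 * 5^(m+(d+K)) * ?x (d+K)"
        by (simp only: add.commute[of d K] power_add ring_distribs mult.assoc)
      finally show ?thesis .
    qed
    then have "3/2 * 5^(m+K) * (?y K - ?x K) \<le> \<Lambda>' - \<Lambda>"
      by (intro LIMSEQ_le_const[OF tendsto_diff[OF lim'(2,1)]] exI[of _ 0] allI impI)
    moreover have "0 < 3/2 * 5^(m+K) * (?y K - ?x K)" using base by (intro mult_pos_pos) simp_all
    ultimately show ?thesis by linarith
  qed
qed

lemma strict_mono_surj_nat:
  fixes r :: "nat \<Rightarrow> nat"
  assumes r: "strict_mono r" "surj r"
  shows "r n = n"
proof -
  have right_inv: "r (inv r m) = m" for m by (rule surj_f_inv_f[OF r(2)])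
  have "strict_mono (inv r)"
  proof (rule strict_monoI)
    fix a b :: nat assume "a < b"
    then have "r (inv r a) < r (inv r b)" by (simp only: right_inv)
    then show "inv r a < inv r b" by (simp only: strict_mono_less[OF r(1)])
  qed
  then have "r n \<le> inv r (r n)" by (rule strict_mono_imp_increasing)
  also have "inv r (r n) = n" by (rule inv_f_f[OF strict_mono_imp_inj_on[OF r(1)]])
  finally show ?thesis using strict_mono_imp_increasing[OF r(1), of n] by (rule antisym)
qed

text \<open>
  The ranks of the generating sign sequences form a strictly increasing surjective sequence of natural
  numbers, and the identity is the only one.
\<close>

lemma enumeration_rank:
  assumes enum: "enumerates_by_eigenvalue q S R \<psi>"
    and l0: "0 < l0" "l0 < 6" and S: "S \<subseteq> admissible_signs m"
    and onto: "\<And>n. \<exists>\<epsilon>\<in>S. sign_rank m \<epsilon> = n"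
    and lim: "\<And>\<epsilon> u \<Lambda>. \<epsilon> \<in> S \<Longrightarrow> R \<epsilon> u \<Longrightarrow> dirichlet_eigenfunction q u \<Lambda> \<Longrightarrow>
       (\<lambda>k. 3/2 * 5^(m+k) * decimation_value m l0 \<epsilon> k) \<longlonglongrightarrow> \<Lambda>"
  shows "\<exists>\<epsilon>\<in>S. R \<epsilon> (\<psi> n) \<and> sign_rank m \<epsilon> = n"
proof -
  obtain \<Lambda> where \<Lambda>: "strict_mono \<Lambda>" "\<And>n. dirichlet_eigenfunction q (\<psi> n) (\<Lambda> n)"
    and gen: "\<And>n. \<exists>\<epsilon>\<in>S. R \<epsilon> (\<psi> n)" and all: "\<And>\<epsilon>. \<epsilon> \<in> S \<Longrightarrow> \<exists>n. R \<epsilon> (\<psi> n)"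
    using enum unfolding enumerates_by_eigenvalue_def by blast
  have ord: "(sign_rank m \<epsilon> = sign_rank m \<delta> \<longrightarrow> \<Lambda> n = \<Lambda> n') \<and> (sign_rank m \<epsilon> < sign_rank m \<delta> \<longrightarrow> \<Lambda> n < \<Lambda> n')"
    if "\<epsilon> \<in> S" "R \<epsilon> (\<psi> n)" "\<delta> \<in> S" "R \<delta> (\<psi> n')" for \<epsilon> \<delta> n n'
    using eigenvalue_order[OF l0 _ _ lim[OF that(1,2) \<Lambda>(2)] lim[OF that(3,4) \<Lambda>(2)]] S that by blast
  obtain e where e: "\<And>n. e n \<in> S" "\<And>n. R (e n) (\<psi> n)" using gen by metis
  define r where "r n = sign_rank m (e n)" for n
  have "strict_mono r"
  proof (rule strict_monoI)
    fix n n' :: nat assume "n < n'"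
    then have "\<Lambda> n < \<Lambda> n'" using \<Lambda>(1) by (simp add: strict_mono_def)
    then show "r n < r n'"
      using ord[OF e(1,2) e(1,2), of n' n]
      by (cases "sign_rank m (e n)" "sign_rank m (e n')" rule: linorder_cases) (auto simp: r_def)
  qed
  moreover have "surj r"
    unfolding surj_def
  proof
    fix k
    obtain \<epsilon> where \<epsilon>: "\<epsilon> \<in> S" "sign_rank m \<epsilon> = k" using onto by blast
    obtain n where n: "R \<epsilon> (\<psi> n)" using all[OF \<epsilon>(1)] by blast
    have "r n = k"
      using ord[OF e(1,2) \<epsilon>(1) n, of n] ord[OF \<epsilon>(1) n e(1,2), of n] \<epsilon>(2)
      by (cases "sign_rank m (e n)" k rule: linorder_cases) (auto simp: r_def)
    then show "\<exists>n. k = r n" by blast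
  qed
  ultimately have "r n = n" by (rule strict_mono_surj_nat)
  then show ?thesis using e[of n] unfolding r_def by blast
qed

section \<open>The three families\<close>

context edge_decimation
begin

text \<open>
  Variation and rank change by reflections at the same steps.  So a function \<open>\<phi>\<close> that intertwines these
  reflections and starts with the right value expresses the variation through the rank.  Thus \<open>\<phi> n\<close> is
  twice the number of extrema of the \<open>n\<close>-th function plus the number of zero slopes at the two ends.
\<close>

lemma edge_extrema_count:
  assumes mm: "matched m0" and m1: "m0 \<le> m1" "lam m1 < 6"
    and start_nonzero: "\<And>n. n < 2^m1 \<Longrightarrow> slope m1 n \<noteq> 0 \<or> slope m1 (Suc n) \<noteq> 0"
    and start_flank: "\<And>n. Suc n < 2^m1 \<Longrightarrow> slope m1 (Suc n) = 0 \<Longrightarrow> slope m1 n * slope m1 (Suc (Suc n)) < 0"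
    and \<epsilon>: "\<epsilon> \<in> admissible_signs m1" and ne: "q i \<noteq> q j"
    and \<phi>0: "\<phi> 0 = (\<Sum>n<2^m1. \<bar>sgn (slope m1 n) - sgn (slope m1 (Suc n))\<bar>)"
    and \<phi>: "\<And>K n. n < 2^K \<Longrightarrow> \<phi> (2^Suc K - 1 - n) = 4 * 2^(m1 + K) - \<phi> n"
  shows "2 * real (card (edge_extrema (q i) (q j) u)) =
    \<phi> (sign_rank m1 \<epsilon>) - of_bool (slope m1 0 = 0) - of_bool (slope m1 (2^m1) = 0)"
proof -
  obtain K where K: "\<forall>m'>m1+K. \<epsilon> m' = -1" using admissible_signs_tail[OF \<epsilon>] by blast
  interpret edge: slope_refinement "\<lambda>t. u (edge_point q i j t)" slope "\<lambda>m. 2 / (6 - lam m)"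
    "\<lambda>m. (6 - lam (Suc m)) / ((2 - lam (Suc m)) * (5 - lam (Suc m)))"
    "\<lambda>m. (6 - lam (Suc m)) / ((5 - lam (Suc m)) * (6 - lam m))" \<epsilon> m1
    by (rule slope_refinementI[OF mm m1 start_nonzero start_flank])
  interpret edge: final_slopes "\<lambda>t. u (edge_point q i j t)" slope "\<lambda>m. 2 / (6 - lam m)"
    "\<lambda>m. (6 - lam (Suc m)) / ((2 - lam (Suc m)) * (5 - lam (Suc m)))"
    "\<lambda>m. (6 - lam (Suc m)) / ((5 - lam (Suc m)) * (6 - lam m))" \<epsilon> m1 "m1 + K"
    by unfold_locales (use K in auto)
  have "edge.variation (m1 + L) = \<phi> (rank_upto m1 \<epsilon> L)" for L
  proof (induction L)
    case 0
    show ?case by (simp add: edge.variation_def \<phi>0)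
  next
    case (Suc L)
    have "edge.variation (m1 + Suc L) =
        (if \<epsilon> (m1 + Suc L) = -1 then \<phi> (rank_upto m1 \<epsilon> L) else 4 * 2^(m1 + L) - \<phi> (rank_upto m1 \<epsilon> L))"
      using edge.variation_Suc[of "m1 + L"] unfolding Suc.IH by simp
    then show ?case unfolding rank_upto.simps using \<phi>[OF rank_upto_less[of m1 \<epsilon> L]] by simp
  qed
  then have "edge.variation (m1 + K) = \<phi> (sign_rank m1 \<epsilon>)" by (simp only: sign_rank_eq[OF K])
  then show ?thesis using edge.card_interior_extrema card_edge_extrema[OF ne, of u] by simp
qed

lemma level_1_values:
  "val (Suc 0) 0 = u (q i)" "val (Suc 0) (Suc 0) = u (midpoint (q i) (q j))"
  "val (Suc 0) (Suc (Suc 0)) = u (q j)"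
  "opp (Suc 0) 0 = u (midpoint (q i) (q k))" "opp (Suc 0) (Suc 0) = u (midpoint (q j) (q k))"
proof -
  have "edge_point q i j 0 = q i" "edge_point q i j 1 = q j"
    "edge_point q i j (1/2) = midpoint (q i) (q j)"
    by (simp_all add: edge_point_def midpoint_def scaleR_add_right)
  then show "val (Suc 0) 0 = u (q i)" "val (Suc 0) (Suc 0) = u (midpoint (q i) (q j))"
    "val (Suc 0) (Suc (Suc 0)) = u (q j)"
    by (simp_all add: val_def)
  show "opp (Suc 0) 0 = u (midpoint (q i) (q k))" "opp (Suc 0) (Suc 0) = u (midpoint (q j) (q k))"
    by (simp_all add: opp_def F_vertex)
qed

lemma level_1:
  shows matched_level_1: "matched (Suc 0) \<longleftrightarrow> right_slope (Suc 0) 0 = left_slope (Suc 0) (Suc 0)"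
    and slope_level_1: "slope (Suc 0) 0 = left_slope (Suc 0) 0"
      "slope (Suc 0) (Suc 0) = left_slope (Suc 0) (Suc 0)"
      "slope (Suc 0) (Suc (Suc 0)) = right_slope (Suc 0) (Suc 0)"
  by (auto simp: matched_def slope_def)

end

lemma edge_decimationI:
  assumes ext: "decimation_extension q m0 l0 \<epsilon> u" and \<epsilon>: "\<epsilon> \<in> admissible_signs m0"
    and l0: "0 < l0" "l0 \<le> 6" "l0 = 6 \<Longrightarrow> \<epsilon> (Suc m0) = 1" and ijk: "distinct [i, j, k]"
  shows "edge_decimation q u (\<lambda>m. decimation_value m0 l0 \<epsilon> (m - m0)) \<epsilon> m0 i j k"
proof
  show "distinct [i, j, k]" by (rule ijk)
  show "continuous_on (SG q) u" using ext by (simp add: decimation_extension_def)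
  fix w a b c
  show "u (midpoint (Fw q w (q a)) (Fw q w (q b))) =
      ((4 - decimation_value m0 l0 \<epsilon> (Suc (length w) - m0)) * (u (Fw q w (q a)) + u (Fw q w (q b)))
        + 2 * u (Fw q w (q c)))
      / ((2 - decimation_value m0 l0 \<epsilon> (Suc (length w) - m0)) * (5 - decimation_value m0 l0 \<epsilon> (Suc (length w) - m0)))"
    if "m0 \<le> length w" "distinct [a, b, c]"
    using ext that unfolding decimation_extension_def Let_def by blast
next
  fix m assume m: "m0 \<le> m"
  then have "Suc m - m0 = Suc (m - m0)" "m0 + Suc (m - m0) = Suc m" by simp_all
  then show "decimation_value m0 l0 \<epsilon> (Suc m - m0) =
      (5 + \<epsilon> (Suc m) * sqrt (25 - 4 * decimation_value m0 l0 \<epsilon> (m - m0))) / 2"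
    by (simp only: decimation_value.simps)
  show "\<epsilon> (Suc m) = 1 \<or> \<epsilon> (Suc m) = - 1" using \<epsilon> m by (simp add: admissible_signs_def)
qed (use l0 in simp_all)

lemma admissible_signs_mono:
  assumes "m \<le> m'"
  shows "admissible_signs m \<subseteq> admissible_signs m'"
proof
  fix \<epsilon> assume \<epsilon>: "\<epsilon> \<in> admissible_signs m"
  have "{l. l > m' \<and> \<epsilon> l \<noteq> -1} \<subseteq> {l. l > m \<and> \<epsilon> l \<noteq> -1}" using assms by auto
  moreover have "finite {l. l > m \<and> \<epsilon> l \<noteq> -1}" using \<epsilon> by (simp add: admissible_signs_def)
  ultimately have "finite {l. l > m' \<and> \<epsilon> l \<noteq> -1}" by (rule finite_subset)
  then show "\<epsilon> \<in> admissible_signs m'" using \<epsilon> assms by (simp add: admissible_signs_def)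
qed

lemma ymid_midpoint:
  "ymid q 0 = midpoint (q 1) (q 2)" "ymid q 1 = midpoint (q 2) (q 0)" "ymid q 2 = midpoint (q 0) (q 1)"
proof -
  have "(0::3) \<in> {1, 2, 3}" using UNIV_3 by blast
  moreover have "(0::3) \<noteq> 1" "(0::3) \<noteq> 2" by simp_all
  ultimately have 3: "(3::3) = 0" by (metis insertE singletonD)
  have "(4::3) = 3 + 1" by simp
  then have 4: "(4::3) = 1" unfolding 3 by simp
  show "ymid q 0 = midpoint (q 1) (q 2)" "ymid q 1 = midpoint (q 2) (q 0)"
    "ymid q 2 = midpoint (q 0) (q 1)"
    by (simp_all add: ymid_def 3 4)
qed

lemma half_complement: "n < P \<Longrightarrow> (2 * P - 1 - n) div 2 = P - 1 - n div (2::nat)"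
  by linarith

lemma complement_less: "n < 2^K \<Longrightarrow> real (2^Suc K - 1 - n) = 2 * 2^K - 1 - real n"
  by (subst of_nat_diff) auto

lemma real_half_complement:
  assumes "n < 2^K"
  shows "real ((2^Suc K - 1 - n) div 2) = 2^K - 1 - real (n div 2)"
proof -
  have "(2^Suc K - 1 - n) div 2 = 2^K - 1 - n div 2" using half_complement[OF assms] by simp
  moreover have "Suc (n div 2) \<le> 2^K" using assms by linarith
  ultimately show ?thesis by (simp add: of_nat_diff del: of_nat_Suc)
qed

locale family_member =
  fixes q :: "3 \<Rightarrow> real^2" and u :: "real^2 \<Rightarrow> real" and \<epsilon> :: "nat \<Rightarrow> real"
  assumes q: "equilateral_triangle q"
begin

lemma vertices_distinct: "i \<noteq> j \<Longrightarrow> q i \<noteq> q j"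
  using inj_triangle[OF q] by (simp add: inj_eq)

end

text \<open>
  The start is symmetric, and the only vanishing slope of level \<open>1\<close> sits at the midpoint of the bottom edge, between
  slopes of opposite signs.
\<close>

locale family2_member = family_member +
  assumes start: "start2 q u" and ext: "decimation_extension q 1 2 \<epsilon> u"
    and \<epsilon>: "\<epsilon> \<in> admissible_signs 1"
begin

definition level_eigenvalue :: "nat \<Rightarrow> real" where
  "level_eigenvalue m = decimation_value 1 2 \<epsilon> (m - 1)"

sublocale edge_decimation q u level_eigenvalue \<epsilon> 1 0 1 2
  unfolding level_eigenvalue_def[abs_def] by (rule edge_decimationI[OF ext \<epsilon>]) auto

lemma start_values: "u (q a) = 0" "u (midpoint (q 0) (q 1)) = 1" "u (midpoint (q 0) (q 2)) = 1"
  "u (midpoint (q 1) (q 2)) = 1"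
  using start unfolding start2_def by (metis ymid_midpoint midpoint_sym)+

lemma start_slopes: "matched 1" "slope 1 0 = 2" "slope 1 1 = 0" "slope 1 2 = -2"
  by (simp_all add: numeral_2_eq_2 level_eigenvalue_def level_1 left_slope_def right_slope_def level_1_values start_values)

lemma limit: "dirichlet_eigenfunction q u \<Lambda> \<Longrightarrow>
    (\<lambda>k. 3/2 * 5^(1+k) * decimation_value 1 2 \<epsilon> k) \<longlonglongrightarrow> \<Lambda>"
  using LIMSEQ_ignore_initial_segment[OF eigenvalue_limit[OF q start_slopes(1)], of \<Lambda> 1]
  by (simp add: start_values level_eigenvalue_def)

lemma count: "card (edge_extrema (q 0) (q 1) u) = 2 * sign_rank 1 \<epsilon> + 1"
proof -
  have "2 * real (card (edge_extrema (q 0) (q 1) u)) =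
      (\<lambda>n. 4 * real n + 2) (sign_rank 1 \<epsilon>) - of_bool (slope 1 0 = 0) - of_bool (slope 1 (2^1) = 0)"
  proof (rule edge_extrema_count[OF start_slopes(1)])
    fix n :: nat
    show "slope 1 n \<noteq> 0 \<or> slope 1 (Suc n) \<noteq> 0" if "n < 2^1"
      using that start_slopes by (auto simp: numeral_2_eq_2 less_Suc_eq)
    show "slope 1 n * slope 1 (Suc (Suc n)) < 0" if "Suc n < 2^1" "slope 1 (Suc n) = 0"
      using that start_slopes by (auto simp: numeral_2_eq_2)
    show "4 * real (2^Suc K - 1 - n) + 2 = 4 * 2^(1+K) - (4 * real n + 2)" if "n < 2^K" for K
      using complement_less[OF that] by simp
  qed (use \<epsilon> vertices_distinct start_slopes in \<open>auto simp: numeral_2_eq_2 level_eigenvalue_def\<close>)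
  then have "real (card (edge_extrema (q 0) (q 1) u)) = real (2 * sign_rank 1 \<epsilon> + 1)"
    using start_slopes by simp
  then show ?thesis by (simp only: of_nat_eq_iff)
qed

end

theorem extrema_family2:
  assumes q: "equilateral_triangle q" and fam: "is_family2 q \<psi>"
  shows "card (edge_extrema (q 0) (q 1) (\<psi> n)) = 2 * n + 1"
proof -
  have "\<exists>\<epsilon>\<in>admissible_signs 1. (start2 q (\<psi> n) \<and> decimation_extension q 1 2 \<epsilon> (\<psi> n)) \<and> sign_rank 1 \<epsilon> = n"
  proof (rule enumeration_rank[OF fam[unfolded is_family2_def]])
    fix \<epsilon> u \<Lambda>
    assume "\<epsilon> \<in> admissible_signs 1" "start2 q u \<and> decimation_extension q 1 2 \<epsilon> u"
      and eig: "dirichlet_eigenfunction q u \<Lambda>"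
    then interpret family2_member q u \<epsilon> using q by unfold_locales auto
    show "(\<lambda>k. 3/2 * 5^(1+k) * decimation_value 1 2 \<epsilon> k) \<longlonglongrightarrow> \<Lambda>" by (rule limit[OF eig])
  qed (use ex_sign_rank in auto)
  then obtain \<epsilon> where e: "\<epsilon> \<in> admissible_signs 1" "start2 q (\<psi> n)"
    "decimation_extension q 1 2 \<epsilon> (\<psi> n)" "sign_rank 1 \<epsilon> = n" by blast
  interpret family2_member q "\<psi> n" \<epsilon> using e q by unfold_locales
  show ?thesis using count e(4) by simp
qed

text \<open>
  The antisymmetric start makes the bottom and the left edge differ.  On the left edge the slope at \<open>q 2\<close>
  vanishes, so that the variation is odd.
\<close>

locale family5_member = family_member +
  assumes start: "start5 q u" and ext: "decimation_extension q 1 5 \<epsilon> u"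
    and \<epsilon>: "\<epsilon> \<in> admissible_signs 1"
begin

definition level_eigenvalue :: "nat \<Rightarrow> real" where
  "level_eigenvalue m = decimation_value 1 5 \<epsilon> (m - 1)"

sublocale bottom: edge_decimation q u level_eigenvalue \<epsilon> 1 0 1 2
  unfolding level_eigenvalue_def[abs_def] by (rule edge_decimationI[OF ext \<epsilon>]) auto

sublocale left: edge_decimation q u level_eigenvalue \<epsilon> 1 0 2 1
  unfolding level_eigenvalue_def[abs_def] by (rule edge_decimationI[OF ext \<epsilon>]) auto

lemma start_values: "u (q a) = 0" "u (midpoint (q 0) (q 1)) = 0" "u (midpoint (q 0) (q 2)) = 1"
  "u (midpoint (q 1) (q 2)) = -1" "u (midpoint (q 2) (q 1)) = -1"
  using start unfolding start5_def by (metis ymid_midpoint midpoint_sym)+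

lemma bottom_slopes: "bottom.matched 1" "bottom.slope 1 0 = 1" "bottom.slope 1 1 = -1" "bottom.slope 1 2 = 1"
  by (simp_all add: numeral_2_eq_2 level_eigenvalue_def bottom.level_1 bottom.left_slope_def bottom.right_slope_def
      bottom.level_1_values start_values)

lemma left_slopes: "left.matched 1" "left.slope 1 0 = 1" "left.slope 1 1 = -1/2" "left.slope 1 2 = 0"
  by (simp_all add: numeral_2_eq_2 level_eigenvalue_def left.level_1 left.left_slope_def left.right_slope_def
      left.level_1_values start_values)

lemma limit: "dirichlet_eigenfunction q u \<Lambda> \<Longrightarrow>
    (\<lambda>k. 3/2 * 5^(1+k) * decimation_value 1 5 \<epsilon> k) \<longlonglongrightarrow> \<Lambda>"
  using LIMSEQ_ignore_initial_segment[OF left.eigenvalue_limit[OF q left_slopes(1)], of \<Lambda> 1]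
  by (simp add: start_values level_eigenvalue_def)

lemma count_bottom: "card (edge_extrema (q 0) (q 1) u) = 4 * (sign_rank 1 \<epsilon> div 2) + 2"
proof -
  have "2 * real (card (edge_extrema (q 0) (q 1) u)) =
      (\<lambda>n. 8 * real (n div 2) + 4) (sign_rank 1 \<epsilon>)
      - of_bool (bottom.slope 1 0 = 0) - of_bool (bottom.slope 1 (2^1) = 0)"
  proof (rule bottom.edge_extrema_count[OF bottom_slopes(1)])
    fix n :: nat
    show "bottom.slope 1 n \<noteq> 0 \<or> bottom.slope 1 (Suc n) \<noteq> 0" if "n < 2^1"
      using that bottom_slopes by (auto simp: numeral_2_eq_2 less_Suc_eq)
    show "bottom.slope 1 n * bottom.slope 1 (Suc (Suc n)) < 0" if "Suc n < 2^1" "bottom.slope 1 (Suc n) = 0"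
      using that bottom_slopes by (auto simp: numeral_2_eq_2)
    show "8 * real ((2^Suc K - 1 - n) div 2) + 4 = 4 * 2^(1+K) - (8 * real (n div 2) + 4)" if "n < 2^K" for K
      unfolding real_half_complement[OF that] by simp
  qed (use \<epsilon> vertices_distinct bottom_slopes in \<open>auto simp: numeral_2_eq_2 level_eigenvalue_def\<close>)
  then have "real (card (edge_extrema (q 0) (q 1) u)) = real (4 * (sign_rank 1 \<epsilon> div 2) + 2)"
    using bottom_slopes by simp
  then show ?thesis by (simp only: of_nat_eq_iff)
qed

lemma count_left: "card (edge_extrema (q 0) (q 2) u) = 2 * (sign_rank 1 \<epsilon> div 2) + sign_rank 1 \<epsilon> + 1"
proof -
  have "2 * real (card (edge_extrema (q 0) (q 2) u)) =
      (\<lambda>n. 4 * real (n div 2) + 2 * real n + 3) (sign_rank 1 \<epsilon>)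
      - of_bool (left.slope 1 0 = 0) - of_bool (left.slope 1 (2^1) = 0)"
  proof (rule left.edge_extrema_count[OF left_slopes(1)])
    fix n :: nat
    show "left.slope 1 n \<noteq> 0 \<or> left.slope 1 (Suc n) \<noteq> 0" if "n < 2^1"
      using that left_slopes by (auto simp: numeral_2_eq_2 less_Suc_eq)
    show "left.slope 1 n * left.slope 1 (Suc (Suc n)) < 0" if "Suc n < 2^1" "left.slope 1 (Suc n) = 0"
      using that left_slopes by (auto simp: numeral_2_eq_2)
    show "4 * real ((2^Suc K - 1 - n) div 2) + 2 * real (2^Suc K - 1 - n) + 3 =
        4 * 2^(1+K) - (4 * real (n div 2) + 2 * real n + 3)" if "n < 2^K" for K
      unfolding real_half_complement[OF that] complement_less[OF that] by simp
  qed (use \<epsilon> vertices_distinct left_slopes in \<open>auto simp: numeral_2_eq_2 level_eigenvalue_def\<close>)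
  then have "real (card (edge_extrema (q 0) (q 2) u)) =
      real (2 * (sign_rank 1 \<epsilon> div 2) + sign_rank 1 \<epsilon> + 1)"
    using left_slopes by simp
  then show ?thesis by (simp only: of_nat_eq_iff)
qed

end

theorem extrema_family5:
  assumes q: "equilateral_triangle q" and fam: "is_family5 q \<psi>"
  shows "card (edge_extrema (q 0) (q 1) (\<psi> n)) = 4 * (n div 2) + 2"
    and "card (edge_extrema (q 0) (q 2) (\<psi> n)) = 2 * (n div 2) + n + 1"
proof -
  have "\<exists>\<epsilon>\<in>admissible_signs 1. (start5 q (\<psi> n) \<and> decimation_extension q 1 5 \<epsilon> (\<psi> n)) \<and> sign_rank 1 \<epsilon> = n"
  proof (rule enumeration_rank[OF fam[unfolded is_family5_def]])
    fix \<epsilon> u \<Lambda>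
    assume "\<epsilon> \<in> admissible_signs 1" "start5 q u \<and> decimation_extension q 1 5 \<epsilon> u"
      and eig: "dirichlet_eigenfunction q u \<Lambda>"
    then interpret family5_member q u \<epsilon> using q by unfold_locales auto
    show "(\<lambda>k. 3/2 * 5^(1+k) * decimation_value 1 5 \<epsilon> k) \<longlonglongrightarrow> \<Lambda>" by (rule limit[OF eig])
  qed (use ex_sign_rank in auto)
  then obtain \<epsilon> where e: "\<epsilon> \<in> admissible_signs 1" "start5 q (\<psi> n)"
    "decimation_extension q 1 5 \<epsilon> (\<psi> n)" "sign_rank 1 \<epsilon> = n" by blast
  interpret family5_member q "\<psi> n" \<epsilon> using e q by unfold_locales
  show "card (edge_extrema (q 0) (q 1) (\<psi> n)) = 4 * (n div 2) + 2"
    "card (edge_extrema (q 0) (q 2) (\<psi> n)) = 2 * (n div 2) + n + 1"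
    using count_bottom count_left e(4) by simp_all
qed

text \<open>
  At level \<open>2\<close>, with eigenvalue \<open>6\<close>, the values on each cell along the edge sum up to zero, so all slopes
  vanish there.  The step to level \<open>3\<close>, with eigenvalue \<open>3\<close>, creates nonzero slopes at the new vertices;
  level \<open>3\<close> is therefore the starting level for counting and for ranking.
\<close>

locale family6_member = family_member +
  assumes start: "start6 q u" and ext: "decimation_extension q 2 6 \<epsilon> u"
    and \<epsilon>: "\<epsilon> \<in> admissible_signs 2" and \<epsilon>3: "\<epsilon> 3 = 1"
begin

definition level_eigenvalue :: "nat \<Rightarrow> real" where
  "level_eigenvalue m = decimation_value 2 6 \<epsilon> (m - 2)"

sublocale edge_decimation q u level_eigenvalue \<epsilon> 2 0 1 2
  unfolding level_eigenvalue_def[abs_def] by (rule edge_decimationI[OF ext \<epsilon>]) (use \<epsilon>3 in \<open>auto simp: numeral_3_eq_3 numeral_2_eq_2\<close>)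

lemma level_3: "level_eigenvalue 3 = 3" "level_eigenvalue 2 = 6"
  unfolding level_eigenvalue_def using \<epsilon>3 by (simp_all add: numeral_3_eq_3 numeral_2_eq_2)

lemma shift: "decimation_value 2 6 \<epsilon> (Suc n) = decimation_value 3 3 \<epsilon> n"
proof (induction n)
  case 0
  show ?case using level_3 by (simp add: level_eigenvalue_def)
next
  case (Suc n)
  have "decimation_value 2 6 \<epsilon> (Suc (Suc n)) =
      (5 + \<epsilon> (2 + Suc (Suc n)) * sqrt (25 - 4 * decimation_value 2 6 \<epsilon> (Suc n))) / 2"
    by (simp only: decimation_value.simps)
  moreover have "2 + Suc (Suc n) = 3 + Suc n" by simp
  ultimately show ?case unfolding Suc.IH by (simp only: decimation_value.simps)
qed

lemma start_values:
  "val 2 0 = 0" "val 2 1 = -1" "val 2 2 = 2" "val 2 3 = -1" "val 2 4 = 0"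
  "opp 2 0 = 1" "opp 2 1 = -1" "opp 2 2 = -1" "opp 2 3 = 1"
proof -
  have pts: "edge_point q 0 1 0 = q 0" "edge_point q 0 1 (1/4) = midpoint (q 0) (ymid q 2)"
    "edge_point q 0 1 (2/4) = ymid q 2" "edge_point q 0 1 (3/4) = midpoint (q 1) (ymid q 2)"
    "edge_point q 0 1 1 = q 1"
    by (simp_all add: ymid_midpoint edge_point_def vec_eq_iff midpoint_def field_simps)
  show "val 2 0 = 0" "val 2 1 = -1" "val 2 2 = 2" "val 2 3 = -1" "val 2 4 = 0"
    using start pts unfolding start6_def by (simp_all add: val_def)
  have "edge_word a b (Suc (Suc 0)) n = [if even (n div 2) then a else b, if even n then a else b]" for a b n
    by simp
  note edge_word_2 = this[folded numeral_2_eq_2]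
  have words: "edge_word 0 1 2 0 = [0, 0]" "edge_word 0 1 2 (Suc 0) = [0, 1]" "edge_word 0 1 2 2 = [1, 0]"
    "edge_word 0 1 2 3 = [1, 1]"
    by (simp_all add: edge_word_2)
  have cells: "F q 0 (F q 0 (q 2)) = midpoint (q 0) (ymid q 1)"
    "F q 0 (F q 1 (q 2)) = midpoint (ymid q 1) (ymid q 2)"
    "F q 1 (F q 0 (q 2)) = midpoint (ymid q 0) (ymid q 2)"
    "F q 1 (F q 1 (q 2)) = midpoint (q 1) (ymid q 0)"
    by (simp_all add: ymid_midpoint F_vertex F_midpoint midpoint_sym)
  show "opp 2 0 = 1" "opp 2 1 = -1" "opp 2 2 = -1" "opp 2 3 = 1"
    using start unfolding start6_def by (simp_all add: opp_def words cells)
qed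

lemma start_matched: "matched 2"
  unfolding matched_def
proof (intro allI impI)
  fix n :: nat assume "Suc n < 2^2"
  then have "n = 0 \<or> n = 1 \<or> n = 2" by auto
  then show "right_slope 2 n = left_slope 2 (Suc n)"
    using start_values level_3 by (auto simp: right_slope_def left_slope_def eval_nat_numeral)
qed

lemma level_2_slopes:
  assumes "n \<le> 4"
  shows "slope 2 n = 0"
proof -
  from assms have "n = 0 \<or> n = 1 \<or> n = 2 \<or> n = 3 \<or> n = 4" by arith
  then show ?thesis
    using start_values level_3 by (auto simp: slope_def right_slope_def left_slope_def eval_nat_numeral)
qed

lemma start_slopes:
  "slope 3 0 = 0" "slope 3 1 = -3/4" "slope 3 2 = 0" "slope 3 3 = 9/4" "slope 3 4 = 0"
  "slope 3 5 = -9/4" "slope 3 6 = 0" "slope 3 7 = 3/4" "slope 3 8 = 0"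
proof -
  have old: "slope 3 (2*n) = 0" if "n \<le> 4" for n
    using slope_old[of 2 n] start_matched level_2_slopes[OF that] that by (simp add: numeral_3_eq_3 numeral_2_eq_2)
  have new: "slope 3 (Suc (2*n)) = 3/4 * (val 2 (Suc n) - val 2 n)" if "n < 4" for n
    using slope_new[of 2 n] that level_3 by (simp add: numeral_3_eq_3 numeral_2_eq_2)
  show "slope 3 0 = 0" "slope 3 2 = 0" "slope 3 4 = 0" "slope 3 6 = 0" "slope 3 8 = 0"
    using old[of 0] old[of 1] old[of 2] old[of 3] old[of 4] by simp_all
  show "slope 3 1 = -3/4" "slope 3 3 = 9/4" "slope 3 5 = -9/4" "slope 3 7 = 3/4"
    using new[of 0] new[of 1] new[of 2] new[of 3] start_values by (simp_all add: eval_nat_numeral)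
qed

lemma limit:
  assumes "dirichlet_eigenfunction q u \<Lambda>"
  shows "(\<lambda>k. 3/2 * 5^(3+k) * decimation_value 3 3 \<epsilon> k) \<longlonglongrightarrow> \<Lambda>"
proof -
  have "u (midpoint (q 0) (q 1)) = 2" using start by (simp add: start6_def ymid_midpoint)
  then have "(\<lambda>n. 3/2 * 5^n * decimation_value 2 6 \<epsilon> (n - 2)) \<longlonglongrightarrow> \<Lambda>"
    using eigenvalue_limit[OF q start_matched _ _ assms] by (simp add: level_eigenvalue_def)
  from LIMSEQ_ignore_initial_segment[OF this, of 3]
  have "(\<lambda>n. 3/2 * 5^(n+3) * decimation_value 2 6 \<epsilon> (n + 3 - 2)) \<longlonglongrightarrow> \<Lambda>" .
  moreover have "n + 3 - 2 = Suc n" for n :: nat by simp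
  ultimately show ?thesis by (simp only: shift add.commute[of _ 3])
qed

lemma count: "card (edge_extrema (q 0) (q 1) u) = 8 * sign_rank 3 \<epsilon> + 3"
proof -
  have "2 * real (card (edge_extrema (q 0) (q 1) u)) =
      (\<lambda>n. 16 * real n + 8) (sign_rank 3 \<epsilon>) - of_bool (slope 3 0 = 0) - of_bool (slope 3 (2^3) = 0)"
  proof (rule edge_extrema_count[OF start_matched])
    fix n :: nat
    show "slope 3 n \<noteq> 0 \<or> slope 3 (Suc n) \<noteq> 0" if "n < 2^3"
    proof -
      have "n = 0 \<or> n = 1 \<or> n = 2 \<or> n = 3 \<or> n = 4 \<or> n = 5 \<or> n = 6 \<or> n = 7" using that by auto
      then show ?thesis using start_slopes by (auto simp: eval_nat_numeral)
    qed
    show "slope 3 n * slope 3 (Suc (Suc n)) < 0" if "Suc n < 2^3" "slope 3 (Suc n) = 0"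
    proof -
      have "n = 0 \<or> n = 1 \<or> n = 2 \<or> n = 3 \<or> n = 4 \<or> n = 5 \<or> n = 6" using that by auto
      then show ?thesis using start_slopes that by (auto simp: eval_nat_numeral)
    qed
    show "16 * real (2^Suc K - 1 - n) + 8 = 4 * 2^(3+K) - (16 * real n + 8)" if "n < 2^K" for K
      unfolding complement_less[OF that] by (simp add: power_add)
    show "\<epsilon> \<in> admissible_signs 3" using \<epsilon> admissible_signs_mono[of 2 3] by auto
    show "16 * real 0 + 8 = (\<Sum>n<2^3. \<bar>sgn (slope 3 n) - sgn (slope 3 (Suc n))\<bar>)"
      using start_slopes by (simp add: eval_nat_numeral)
    show "level_eigenvalue 3 < 6" using level_3 by simp
  qed (use vertices_distinct in auto)
  then have "real (card (edge_extrema (q 0) (q 1) u)) = real (8 * sign_rank 3 \<epsilon> + 3)"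
    using start_slopes by simp
  then show ?thesis by (simp only: of_nat_eq_iff)
qed

end

theorem extrema_family6:
  assumes q: "equilateral_triangle q" and fam: "is_family6 q \<psi>"
  shows "card (edge_extrema (q 0) (q 1) (\<psi> n)) = 8 * n + 3"
proof -
  let ?S = "{\<epsilon> \<in> admissible_signs 2. \<epsilon> 3 = 1}"
  have "\<exists>\<epsilon>\<in>?S. (start6 q (\<psi> n) \<and> decimation_extension q 2 6 \<epsilon> (\<psi> n)) \<and> sign_rank 3 \<epsilon> = n"
  proof (rule enumeration_rank[OF fam[unfolded is_family6_def]])
    fix \<epsilon> u \<Lambda>
    assume "\<epsilon> \<in> ?S" "start6 q u \<and> decimation_extension q 2 6 \<epsilon> u"
      and eig: "dirichlet_eigenfunction q u \<Lambda>"
    then interpret family6_member q u \<epsilon> using q by unfold_locales auto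
    show "(\<lambda>k. 3/2 * 5^(3+k) * decimation_value 3 3 \<epsilon> k) \<longlonglongrightarrow> \<Lambda>" by (rule limit[OF eig])
  next
    show "?S \<subseteq> admissible_signs 3" using admissible_signs_mono[of 2 3] by auto
  next
    fix n
    obtain \<epsilon> where \<epsilon>: "\<epsilon> \<in> admissible_signs 3" "sign_rank 3 \<epsilon> = n" using ex_sign_rank by blast
    have "{m. m > 2 \<and> (\<epsilon>(3 := 1)) m \<noteq> -1} \<subseteq> insert 3 {m. m > 3 \<and> \<epsilon> m \<noteq> -1}" by auto
    moreover have "finite (insert 3 {m. m > 3 \<and> \<epsilon> m \<noteq> -1})" using \<epsilon> by (simp add: admissible_signs_def)
    ultimately have "finite {m. m > 2 \<and> (\<epsilon>(3 := 1)) m \<noteq> -1}" by (rule finite_subset)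
    moreover have "(\<epsilon>(3 := 1)) m \<in> {1, -1}" if "m > 2" for m
      using \<epsilon>(1) that by (cases "m = 3") (auto simp: admissible_signs_def)
    ultimately have "\<epsilon>(3 := 1) \<in> ?S" by (auto simp: admissible_signs_def)
    moreover have "sign_rank 3 (\<epsilon>(3 := 1)) = n"
      using sign_rank_cong[of 3 "\<epsilon>(3 := 1)" \<epsilon>] \<epsilon>(2) by simp
    ultimately show "\<exists>\<epsilon>\<in>?S. sign_rank 3 \<epsilon> = n" by blast
  qed auto
  then obtain \<epsilon> where e: "\<epsilon> \<in> ?S" "start6 q (\<psi> n)"
    "decimation_extension q 2 6 \<epsilon> (\<psi> n)" "sign_rank 3 \<epsilon> = n" by blast
  interpret family6_member q "\<psi> n" \<epsilon> using e q by unfold_locales auto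
  show ?thesis using count e(4) by simp
qed

theorem theorem1p5:
  fixes q :: "3 \<Rightarrow> real^2" and \<psi>2 \<psi>5 \<psi>6 :: "nat \<Rightarrow> real^2 \<Rightarrow> real"
  assumes "equilateral_triangle q"
    and "is_family2 q \<psi>2" and "is_family5 q \<psi>5" and "is_family6 q \<psi>6"
  shows "\<forall>n. card (edge_extrema (q 0) (q 1) (\<psi>2 n)) = 2 * n + 1 \<and>
             card (edge_extrema (q 0) (q 1) (\<psi>5 n)) = 4 * (n div 2) + 2 \<and>
             card (edge_extrema (q 0) (q 1) (\<psi>6 n)) = 8 * n + 3 \<and>
             card (edge_extrema (q 0) (q 2) (\<psi>5 n)) = 2 * (n div 2) + n + 1"
  using extrema_family2[OF assms(1,2)] extrema_family5[OF assms(1,3)] extrema_family6[OF assms(1,4)]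
  by blast

end
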